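(* Let $n\ge1$ and $a_1,\dots,a_n\in\mathbb R$, and consider the single-input system in controllable canonical form $$\dot x_i=x_{i+1}\quad(1\le i\le n-1),\qquad \dot x_n=\sum_{i=1}^n a_ix_i+u,$$ with state $\mathbf x=(x_1,\dots,x_n)^T\in\mathbb R^n$ and input $u\in\mathbb R$. Let $x_1^d\in\mathbb R$ be a constant, and let the desired state be $\mathbf x^d=(x_1^d,0,\dots,0)^T\in\mathbb R^n$. Let $k_1,\dots,k_n>0$ and $\frac{n-1}{n}<\alpha<1$, and define recursively, along the closed-loop trajectory, $$x_{i+1}^d=-k_i\operatorname{sign}(x_i-x_i^d)\,|x_i-x_i^d|^{\alpha}+\dot x_i^d,\qquad 1\le i\le n-1,$$ with $\dot x_1^d=0$. Then, with the control law $$u=\dot x_n^d-\sum_{i=1}^n a_ix_i-k_n\operatorname{sign}(x_n-x_n^d)\,|x_n-x_n^d|^{\alpha},$$ the system reaches the desired state $\mathbf x^d$ in finite time, i.e. there exists $T<\infty$ such that $\mathbf x(t)=\mathbf x^d$ for all $t\ge T$. Furthermore, the controller $u$ remains bounded.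
   Context: $\operatorname{sign}(x)=-1,0,1$ for $x<0$, $x=0$, $x>0$. The dots on $x_i^d$ denote time derivatives along the closed-loop trajectory. The scalar quantities $x_i^d$ for $i\ge2$ are those given by the recursion; they are not the (zero) components of the target vector $\mathbf x^d$. *)

theory Defs
  imports "HOL-Analysis.Analysis"
begin

text \<open>
  A state of \<open>\<real>\<^sup>n\<close> is a function on \<open>nat\<close> of which only the components with index in
  \<open>{1..n}\<close> are meaningful; a trajectory \<open>x\<close> has components \<open>x t i\<close>. Time is \<open>{0..}\<close>, and
  derivatives at \<open>0\<close> are one-sided.
\<close>

definition sig_pow :: "real \<Rightarrow> real \<Rightarrow> real" where
  "sig_pow \<alpha> y = sgn y * \<bar>y\<bar> powr \<alpha>"

definition canonical_form_trajectory ::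
    "nat \<Rightarrow> (nat \<Rightarrow> real) \<Rightarrow> (real \<Rightarrow> real) \<Rightarrow> (real \<Rightarrow> nat \<Rightarrow> real) \<Rightarrow> bool" where
  "canonical_form_trajectory n a u x \<longleftrightarrow>
     (\<forall>t\<ge>0.
        (\<forall>i\<in>{1..<n}. ((\<lambda>s. x s i) has_real_derivative x t (Suc i)) (at t within {0..})) \<and>
        ((\<lambda>s. x s n) has_real_derivative (\<Sum>i=1..n. a i * x t i) + u t) (at t within {0..}))"

text \<open>
  In the next two definitions \<open>xd t i\<close> is the scalar reference \<open>x\<^sub>i\<^sup>d\<close> and \<open>dxd t i\<close> its time
  derivative along the trajectory. Every \<open>x\<^sub>i\<^sup>d\<close> with \<open>1 \<le> i \<le> n\<close> is required to be
  differentiable at every time \<open>t \<ge> 0\<close>, so that the recursion and the control law make sense: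
  \<open>sig_pow \<alpha>\<close> is not differentiable at \<open>0\<close>.
\<close>

definition reference_recursion ::
    "nat \<Rightarrow> (nat \<Rightarrow> real) \<Rightarrow> real \<Rightarrow> real \<Rightarrow> (real \<Rightarrow> nat \<Rightarrow> real) \<Rightarrow>
     (real \<Rightarrow> nat \<Rightarrow> real) \<Rightarrow> (real \<Rightarrow> nat \<Rightarrow> real) \<Rightarrow> bool" where
  "reference_recursion n k \<alpha> x1d x xd dxd \<longleftrightarrow>
     (\<forall>t\<ge>0.
        xd t 1 = x1d \<and> dxd t 1 = 0 \<and>
        (\<forall>i\<in>{1..n}. ((\<lambda>s. xd s i) has_real_derivative dxd t i) (at t within {0..})) \<and>
        (\<forall>i\<in>{1..<n}. xd t (Suc i) = - k i * sig_pow \<alpha> (x t i - xd t i) + dxd t i))"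

definition control_law ::
    "nat \<Rightarrow> (nat \<Rightarrow> real) \<Rightarrow> (nat \<Rightarrow> real) \<Rightarrow> real \<Rightarrow> (real \<Rightarrow> nat \<Rightarrow> real) \<Rightarrow>
     (real \<Rightarrow> nat \<Rightarrow> real) \<Rightarrow> (real \<Rightarrow> nat \<Rightarrow> real) \<Rightarrow> (real \<Rightarrow> real) \<Rightarrow> bool" where
  "control_law n a k \<alpha> x xd dxd u \<longleftrightarrow>
     (\<forall>t\<ge>0. u t = dxd t n - (\<Sum>i=1..n. a i * x t i) - k n * sig_pow \<alpha> (x t n - xd t n))"

definition desired_state :: "real \<Rightarrow> nat \<Rightarrow> real" where
  "desired_state x1d i = (if i = 1 then x1d else 0)"

end

theory Submission
  imports Defs
begin

text \<open>
  The errors \<open>e\<^sub>i = x\<^sub>i - x\<^sub>i\<^sup>d\<close> satisfy the cascade \<open>e\<^sub>i' = e\<^sub>i\<^sub>+\<^sub>1 - k\<^sub>i sig(e\<^sub>i)\<close> with \<open>e\<^sub>n\<^sub>+\<^sub>1 = 0\<close>,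
  where \<open>sig y = sgn y \<bar>y\<bar>\<^sup>\<alpha>\<close>, so they reach \<open>0\<close> in finite time one after the other, starting with \<open>e\<^sub>n\<close>.
  Once all errors vanish, the recursion forces \<open>x\<^sub>i\<^sup>d = 0\<close> for \<open>i \<ge> 2\<close>.

  For the control, the problem is to bound the derivative of \<open>x\<^sub>n\<^sup>d\<close>, that is, the derivatives of
  \<open>sig(e\<^sub>i)\<close> of order \<open>n - i\<close>. Differentiability of the \<open>x\<^sub>i\<^sup>d\<close> implies that \<open>e\<^sub>i\<^sub>+\<^sub>1\<close> vanishes wherever
  \<open>e\<^sub>i\<close> does. A comparison argument then yields \<open>\<bar>e\<^sub>i\<^sub>+\<^sub>1\<bar> \<le> C \<bar>e\<^sub>i\<bar>\<^sup>\<alpha>\<close>. With \<open>p = 1 / (1 - \<alpha>)\<close> and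
  \<open>r\<^sub>i = \<bar>e\<^sub>i\<bar> powr (1 / p)\<close>, which is Lipschitz at its zeros, this gives inductively that the \<open>j\<close>-th derivative of
  \<open>e\<^sub>i\<close> is \<open>O(r\<^sub>i powr (p - j))\<close>, and that of \<open>sig(e\<^sub>i)\<close> is \<open>O(r\<^sub>i powr (p - 1 - j))\<close>. The hypothesis on \<open>\<alpha>\<close>
  says \<open>p > n\<close>, so all the exponents that occur are positive.
\<close>

section \<open>Signed powers and one-sided comparison principles\<close>

lemma abs_sig_pow: "\<bar>sig_pow b y\<bar> = \<bar>y\<bar> powr b"
  by (cases "y = 0") (auto simp: sig_pow_def abs_mult)

lemma sig_pow_minus: "sig_pow b (- y) = - sig_pow b y"
  by (simp add: sig_pow_def sgn_minus)

lemma sig_pow_nonneg: "y \<ge> 0 \<Longrightarrow> sig_pow b y = y powr b"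
  by (cases "y = 0") (auto simp: sig_pow_def)

lemma has_real_derivative_abs_powr:
  assumes "y \<noteq> 0"
  shows "((\<lambda>y. \<bar>y\<bar> powr b) has_real_derivative b * sig_pow (b - 1) y) (at y)"
proof -
  have "((\<lambda>y. \<bar>y\<bar>) has_real_derivative sgn y) (at y)"
  proof (cases "y > 0")
    case True
    have "((\<lambda>y. y) has_real_derivative sgn y) (at y)"
      using True by (auto intro!: derivative_eq_intros)
    then show ?thesis
      by (rule has_field_derivative_transform_within_open[where S="{0<..}"]) (use True in auto)
  next
    case False
    with assms have "y < 0" by simp
    have "((\<lambda>y. - y) has_real_derivative sgn y) (at y)"
      using \<open>y < 0\<close> by (auto intro!: derivative_eq_intros)
    then show ?thesis
      by (rule has_field_derivative_transform_within_open[where S="{..<0}"]) (use \<open>y < 0\<close> in auto)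
  qed
  with has_real_derivative_powr[of "\<bar>y\<bar>" b] assms
  have "((\<lambda>y. \<bar>y\<bar> powr b) has_real_derivative b * \<bar>y\<bar> powr (b - 1) * sgn y) (at y)"
    by (intro DERIV_chain2[where f="\<lambda>z. z powr b" and g=abs]) auto
  then show ?thesis by (simp add: sig_pow_def mult_ac)
qed

lemma has_real_derivative_sig_pow:
  assumes "y \<noteq> 0"
  shows "(sig_pow b has_real_derivative b * \<bar>y\<bar> powr (b - 1)) (at y)"
proof -
  have "((\<lambda>z. sgn y * \<bar>z\<bar> powr b) has_real_derivative sgn y * (b * sig_pow (b - 1) y)) (at y)"
    by (intro DERIV_cmult has_real_derivative_abs_powr assms)
  moreover have "sgn y * (b * sig_pow (b - 1) y) = b * \<bar>y\<bar> powr (b - 1)"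
    using assms by (simp add: sig_pow_def sgn_if)
  ultimately have d: "((\<lambda>z. sgn y * \<bar>z\<bar> powr b) has_real_derivative b * \<bar>y\<bar> powr (b - 1)) (at y)"
    by simp
  have "open {z. z * y > 0}"
    by (intro open_Collect_less continuous_intros)
  then show ?thesis
    by (rule has_field_derivative_transform_within_open[OF d])
       (use assms in \<open>auto simp: sig_pow_def zero_less_mult_iff sgn_if\<close>)
qed

text \<open>By compactness there is a last time \<open>s\<close> with \<open>f s \<le> 0\<close>;
  beyond it \<open>f\<close> is positive, hence nonincreasing. Asking for a derivative only where
  \<open>f > 0\<close> allows \<open>f\<close> to contain powers that are not differentiable at
  zeros of their base.\<close>

lemma nonpos_forward:
  fixes f :: "real \<Rightarrow> real"
  assumes "a \<le> b" "continuous_on {a..b} f" "f a \<le> 0"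
    and deriv: "\<And>t. a < t \<Longrightarrow> t < b \<Longrightarrow> f t > 0 \<Longrightarrow> \<exists>d\<le>0. (f has_real_derivative d) (at t)"
  shows "f b \<le> 0"
proof (rule ccontr)
  assume "\<not> f b \<le> 0"
  let ?S = "{t \<in> {a..b}. f t \<le> 0}"
  have "closed ?S"
    using continuous_closed_preimage[OF assms(2), of "{..0}"] by (auto simp: vimage_def Int_def)
  moreover have "?S = {a..b} \<inter> ?S" by auto
  ultimately have "compact ?S"
    using compact_Int_closed[of "{a..b}" ?S] by simp
  moreover have "a \<in> ?S" using assms by simp
  ultimately obtain s where s: "s \<in> ?S" "\<And>t. t \<in> ?S \<Longrightarrow> t \<le> s"
    using compact_attains_sup[of ?S] by blast
  have "s < b" using s(1) \<open>\<not> f b \<le> 0\<close> by (cases "s = b") auto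
  have "f b \<le> f s"
  proof (rule DERIV_nonpos_imp_decreasing_open[of s b f])
    show "s \<le> b" using \<open>s < b\<close> by simp
    show "continuous_on {s..b} f"
      using assms(2) by (rule continuous_on_subset) (use s in auto)
    fix t assume t: "s < t" "t < b"
    then have "f t > 0" using s(1) s(2)[of t] by (cases "f t > 0") auto
    then show "\<exists>y. (f has_real_derivative y) (at t) \<and> y \<le> 0"
      using deriv[of t] t s(1) by auto
  qed
  then show False using s(1) \<open>\<not> f b \<le> 0\<close> by simp
qed

lemma nonpos_backward:
  fixes f :: "real \<Rightarrow> real"
  assumes "a \<le> b" "continuous_on {a..b} f" "f b \<le> 0"
    and deriv: "\<And>t. a < t \<Longrightarrow> t < b \<Longrightarrow> f t > 0 \<Longrightarrow> \<exists>d\<ge>0. (f has_real_derivative d) (at t)"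
  shows "f a \<le> 0"
proof -
  have "f (- (- a)) \<le> 0"
  proof (rule nonpos_forward[where a = "- b" and b = "- a" and f = "\<lambda>t. f (- t)"])
    show "continuous_on {- b..- a} (\<lambda>t. f (- t))"
      by (rule continuous_on_compose2[OF assms(2)]) (auto intro!: continuous_intros)
    fix t assume "- b < t" "t < - a" "f (- t) > 0"
    then obtain d where "d \<ge> 0" "(f has_real_derivative d) (at (- t))"
      using deriv[of "- t"] by auto
    then show "\<exists>d\<le>0. ((\<lambda>t. f (- t)) has_real_derivative d) (at t)"
      by (intro exI[of _ "- d"]) (simp add: DERIV_mirror)
  qed (use assms in auto)
  then show ?thesis by simp
qed

subsection \<open>Weighted differentiability\<close>

text \<open>
  \<open>f\<close> has \<open>m\<close> derivatives on \<open>S\<close>, and its \<open>j\<close>-th derivative is \<open>O(r powr (q - j))\<close> on \<open>A\<close>. Where \<open>r = 0\<close> the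
  bound forces the value \<open>0\<close>, because \<open>0 powr q = 0\<close> for every \<open>q\<close>. Plain differentiability is the case \<open>A = {}\<close>.
\<close>

primrec weighted_diff ::
  "real set \<Rightarrow> real set \<Rightarrow> (real \<Rightarrow> real) \<Rightarrow> nat \<Rightarrow> real \<Rightarrow> (real \<Rightarrow> real) \<Rightarrow> bool" where
  "weighted_diff A S r 0 q f \<longleftrightarrow> (\<exists>C. \<forall>t\<in>A. \<bar>f t\<bar> \<le> C * r t powr q)"
| "weighted_diff A S r (Suc m) q f \<longleftrightarrow> (\<exists>C. \<forall>t\<in>A. \<bar>f t\<bar> \<le> C * r t powr q) \<and>
     (\<exists>f'. (\<forall>t\<in>S. (f has_real_derivative f' t) (at t within {0..})) \<and>
        weighted_diff A S r m (q - 1) f')"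

lemma weighted_diff_SucI:
  assumes "\<exists>C. \<forall>t\<in>A. \<bar>f t\<bar> \<le> C * r t powr q"
    and "\<forall>t\<in>S. (f has_real_derivative f' t) (at t within {0..})"
    and "weighted_diff A S r m (q - 1) f'"
  shows "weighted_diff A S r (Suc m) q f"
  using assms by auto

lemma weighted_diff_bound:
  "weighted_diff A S r m q f \<Longrightarrow> \<exists>C. \<forall>t\<in>A. \<bar>f t\<bar> \<le> C * r t powr q"
  by (cases m) auto

lemma weighted_diff_SucE:
  assumes "weighted_diff A S r (Suc m) q f"
  obtains f' where "\<forall>t\<in>S. (f has_real_derivative f' t) (at t within {0..})"
    and "weighted_diff A S r m (q - 1) f'"
  using assms by auto

lemma weighted_diff_Suc_D:
  "weighted_diff A S r (Suc m) q f \<Longrightarrow> weighted_diff A S r m q f"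
proof (induction m arbitrary: q f)
  case (Suc m)
  obtain f' where "\<forall>t\<in>S. (f has_real_derivative f' t) (at t within {0..})"
    "weighted_diff A S r (Suc m) (q - 1) f'"
    using weighted_diff_SucE[OF Suc.prems] .
  with Suc.IH weighted_diff_bound[OF Suc.prems] show ?case
    by (intro weighted_diff_SucI)
qed auto

lemma weighted_diff_le:
  "m \<le> m' \<Longrightarrow> weighted_diff A S r m' q f \<Longrightarrow> weighted_diff A S r m q f"
  by (induction rule: inc_induct) (blast dest: weighted_diff_Suc_D)+

lemma weighted_diff_subset:
  "S' \<subseteq> S \<Longrightarrow> weighted_diff A S r m q f \<Longrightarrow> weighted_diff A S' r m q f"
  by (induction m arbitrary: q f) (simp, fastforce)

lemma weighted_diff_zero: "weighted_diff A S r m q (\<lambda>_. 0)"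
proof (induction m arbitrary: q)
  case 0 show ?case by (auto intro!: exI[of _ 0])
next
  case (Suc m)
  then show ?case by (auto intro!: exI[of _ 0] exI[of _ "\<lambda>_. 0"])
qed

lemma weighted_diff_const:
  "\<exists>C. \<forall>t\<in>A. \<bar>c\<bar> \<le> C * r t powr q \<Longrightarrow> weighted_diff A S r m q (\<lambda>_. c)"
  using weighted_diff_zero by (cases m) (auto intro!: exI[of _ "\<lambda>_. 0"])

text \<open>The hypothesis \<open>op\<close> says that \<open>S\<close> is relatively open in
  \<open>{0..}\<close>, so that agreement on \<open>S\<close> is agreement near each point of
  \<open>S\<close> and carries over to derivatives.\<close>

lemma weighted_diff_cong:
  assumes "A \<subseteq> S" and eq: "\<And>t. t \<in> S \<Longrightarrow> f t = g t"
    and op: "\<And>t. t \<in> S \<Longrightarrow> \<forall>\<^sub>F s in at t within {0..}. s \<in> S"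
    and "weighted_diff A S r m q f"
  shows "weighted_diff A S r m q g"
proof -
  obtain C where "\<forall>t\<in>A. \<bar>f t\<bar> \<le> C * r t powr q"
    using weighted_diff_bound[OF assms(4)] by blast
  moreover have "g t = f t" if "t \<in> A" for t using eq that \<open>A \<subseteq> S\<close> by auto
  ultimately have bound: "\<exists>C. \<forall>t\<in>A. \<bar>g t\<bar> \<le> C * r t powr q"
    by (intro exI[of _ C]) auto
  show ?thesis
  proof (cases m)
    case 0
    then show ?thesis using bound by simp
  next
    case (Suc l)
    obtain f' where d: "\<forall>t\<in>S. (f has_real_derivative f' t) (at t within {0..})"
      and f': "weighted_diff A S r l (q - 1) f'"
      using assms(4) unfolding Suc by (rule weighted_diff_SucE)
    have "\<forall>t\<in>S. (g has_real_derivative f' t) (at t within {0..})"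
    proof
      fix t assume "t \<in> S"
      have "\<forall>\<^sub>F s in at t within {0..}. f s = g s"
        using op[OF \<open>t \<in> S\<close>] by eventually_elim (rule eq)
      then show "(g has_real_derivative f' t) (at t within {0..})"
        using has_field_derivative_cong_eventually[of f g t "{0..}" "f' t"] d eq \<open>t \<in> S\<close> by blast
    qed
    then show ?thesis unfolding Suc by (rule weighted_diff_SucI[OF bound _ f'])
  qed
qed

lemma has_real_derivative_within_Ici_unique:
  assumes "(f has_real_derivative a) (at t within {0..})"
    and "(f has_real_derivative b) (at t within {0..})" and "t \<ge> (0::real)"
  shows "a = b"
proof -
  have "at_right t \<le> at t within {0..}"
    using assms(3) by (intro at_le) auto
  then have "at t within {0..} \<noteq> bot"
    using trivial_limit_at_right_real[of t] by (auto simp: bot_unique)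
  then show ?thesis
    using assms(1,2) tendsto_unique unfolding has_field_derivative_iff by blast
qed

text \<open>The derivative in \<open>weighted_diff\<close> is only asserted to exist; uniqueness of
  derivatives on the half line identifies it with the given \<open>g\<close>.\<close>

lemma weighted_diff_derivative:
  assumes "A \<subseteq> S" "S \<subseteq> {0..}"
    and op: "\<And>t. t \<in> S \<Longrightarrow> \<forall>\<^sub>F s in at t within {0..}. s \<in> S"
    and "weighted_diff A S r (Suc m) q f"
    and d: "\<And>t. t \<in> S \<Longrightarrow> (f has_real_derivative g t) (at t within {0..})"
  shows "weighted_diff A S r m (q - 1) g"
proof -
  obtain f' where f': "\<forall>t\<in>S. (f has_real_derivative f' t) (at t within {0..})"
    "weighted_diff A S r m (q - 1) f'"
    using assms(4) by (rule weighted_diff_SucE)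
  have "f' t = g t" if "t \<in> S" for t
    using has_real_derivative_within_Ici_unique[of f "f' t" t "g t"] f'(1) d that assms(2) by auto
  from weighted_diff_cong[OF assms(1) this op f'(2)] show ?thesis .
qed

lemma weighted_diff_add:
  "weighted_diff A S r m q f \<Longrightarrow> weighted_diff A S r m q g \<Longrightarrow>
   weighted_diff A S r m q (\<lambda>t. f t + g t)"
proof (induction m arbitrary: q f g)
  have bound: "\<exists>C. \<forall>t\<in>A. \<bar>f t + g t\<bar> \<le> C * r t powr q"
    if f: "\<exists>C. \<forall>t\<in>A. \<bar>f t\<bar> \<le> C * r t powr q" and g: "\<exists>C. \<forall>t\<in>A. \<bar>g t\<bar> \<le> C * r t powr q"
    for f g q
  proof -
    from f g obtain C D where "\<forall>t\<in>A. \<bar>f t\<bar> \<le> C * r t powr q" "\<forall>t\<in>A. \<bar>g t\<bar> \<le> D * r t powr q"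
      by blast
    then have "\<forall>t\<in>A. \<bar>f t + g t\<bar> \<le> (C + D) * r t powr q"
      by (smt (verit, best) distrib_right)
    then show ?thesis by blast
  qed
  {
    case 0
    then show ?case using bound by simp
  next
    case (Suc m)
    then obtain f' g' where "\<forall>t\<in>S. (f has_real_derivative f' t) (at t within {0..})"
      "weighted_diff A S r m (q - 1) f'" "\<forall>t\<in>S. (g has_real_derivative g' t) (at t within {0..})"
      "weighted_diff A S r m (q - 1) g'"
      by auto
    then show ?case
      using bound[OF Suc.prems[THEN weighted_diff_bound]] Suc.IH[of "q - 1" f' g']
      by (intro weighted_diff_SucI[where f' = "\<lambda>t. f' t + g' t"]) (auto intro: DERIV_add)
  }
qed

lemma weighted_diff_mult:
  "weighted_diff A S r m q f \<Longrightarrow> weighted_diff A S r m q' g \<Longrightarrow>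
   weighted_diff A S r m (q + q') (\<lambda>t. f t * g t)"
proof (induction m arbitrary: q q' f g)
  have bound: "\<exists>C. \<forall>t\<in>A. \<bar>f t * g t\<bar> \<le> C * r t powr (q + q')"
    if f: "\<exists>C. \<forall>t\<in>A. \<bar>f t\<bar> \<le> C * r t powr q" and g: "\<exists>C. \<forall>t\<in>A. \<bar>g t\<bar> \<le> C * r t powr q'"
    for f g q q'
  proof -
    from f g obtain C D where CD: "\<forall>t\<in>A. \<bar>f t\<bar> \<le> C * r t powr q" "\<forall>t\<in>A. \<bar>g t\<bar> \<le> D * r t powr q'"
      by blast
    have "\<forall>t\<in>A. \<bar>f t * g t\<bar> \<le> (C * D) * r t powr (q + q')"
    proof
      fix t assume "t \<in> A"
      then have "\<bar>f t\<bar> * \<bar>g t\<bar> \<le> (C * r t powr q) * (D * r t powr q')"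
        using CD by (intro mult_mono') auto
      then show "\<bar>f t * g t\<bar> \<le> (C * D) * r t powr (q + q')"
        by (simp add: abs_mult powr_add mult_ac)
    qed
    then show ?thesis by blast
  qed
  {
    case 0
    then show ?case using bound by simp
  next
    case (Suc m)
    then obtain f' g' where f': "\<forall>t\<in>S. (f has_real_derivative f' t) (at t within {0..})"
        "weighted_diff A S r m (q - 1) f'"
      and g': "\<forall>t\<in>S. (g has_real_derivative g' t) (at t within {0..})"
        "weighted_diff A S r m (q' - 1) g'"
      by auto
    \<comment> \<open>Product rule: each summand loses one degree in exactly one factor, so both
      have total degree \<open>q + q' - 1\<close>.\<close>
    have "weighted_diff A S r m (q - 1 + q') (\<lambda>t. f' t * g t)"
      "weighted_diff A S r m (q' - 1 + q) (\<lambda>t. g' t * f t)"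
      using Suc.IH[OF f'(2) weighted_diff_Suc_D[OF Suc.prems(2)]]
        Suc.IH[OF g'(2) weighted_diff_Suc_D[OF Suc.prems(1)]] by auto
    moreover have "q - 1 + q' = q + q' - 1" "q' - 1 + q = q + q' - 1" by simp_all
    ultimately have "weighted_diff A S r m (q + q' - 1) (\<lambda>t. f' t * g t + g' t * f t)"
      by (metis weighted_diff_add)
    moreover have "\<forall>t\<in>S. ((\<lambda>t. f t * g t) has_real_derivative f' t * g t + g' t * f t) (at t within {0..})"
      using f' g' by (blast intro: DERIV_mult)
    ultimately show ?case
      using bound[OF Suc.prems[THEN weighted_diff_bound]] by (intro weighted_diff_SucI)
  }
qed

lemma weighted_diff_cmult:
  assumes "weighted_diff A S r m q f" shows "weighted_diff A S r m q (\<lambda>t. c * f t)"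
  using assms
proof (induction m arbitrary: q f)
  have bound: "\<exists>C. \<forall>t\<in>A. \<bar>c * f t\<bar> \<le> C * r t powr q"
    if f: "\<exists>C. \<forall>t\<in>A. \<bar>f t\<bar> \<le> C * r t powr q" for f q
  proof -
    from f obtain C where C: "\<forall>t\<in>A. \<bar>f t\<bar> \<le> C * r t powr q" by blast
    have "\<forall>t\<in>A. \<bar>c * f t\<bar> \<le> (\<bar>c\<bar> * C) * r t powr q"
      using C by (simp add: abs_mult mult_left_mono mult.assoc)
    then show ?thesis by blast
  qed
  {
    case 0
    then show ?case using bound by simp
  next
    case (Suc m)
    then obtain f' where "\<forall>t\<in>S. (f has_real_derivative f' t) (at t within {0..})"
        "weighted_diff A S r m (q - 1) f'"
      by auto
    then show ?case
      using bound[OF Suc.prems[THEN weighted_diff_bound]] Suc.IH[of "q - 1" f']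
      by (intro weighted_diff_SucI[where f' = "\<lambda>t. c * f' t"]) (auto intro: DERIV_cmult)
  }
qed

text \<open>The two powers are treated together because each one's derivative contains the other
  with exponent \<open>b - 1\<close>. Degrees match since
  \<open>p * (b - 1) + (p - 1) = p * b - 1\<close>. The order 0 bound is an equality, as
  \<open>\<bar>f\<bar> = r powr p\<close> on \<open>A\<close>.\<close>

lemma weighted_diff_powr:
  assumes nz: "\<And>t. t \<in> S \<Longrightarrow> f t \<noteq> 0" and r: "\<And>t. t \<in> A \<Longrightarrow> \<bar>f t\<bar> = r t powr p"
    and "weighted_diff A S r m p f"
  shows "weighted_diff A S r m (p * b) (\<lambda>t. \<bar>f t\<bar> powr b) \<and>
         weighted_diff A S r m (p * b) (\<lambda>t. sig_pow b (f t))"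
  using assms(3)
proof (induction m arbitrary: b)
  have bound: "\<exists>C. \<forall>t\<in>A. \<bar>f t\<bar> powr b \<le> C * r t powr (p * b)" for b
    by (intro exI[of _ 1]) (simp add: r powr_powr)
  {
    case 0
    then show ?case using bound by (simp add: abs_sig_pow)
  next
    case (Suc m)
    then obtain f' where f': "\<forall>t\<in>S. (f has_real_derivative f' t) (at t within {0..})"
        "weighted_diff A S r m (p - 1) f'"
      by auto
    have eq: "p * (b - 1) + (p - 1) = p * b - 1"
      by (simp add: algebra_simps)
    note IH = Suc.IH[OF weighted_diff_Suc_D[OF Suc.prems], of "b - 1"]
    have "weighted_diff A S r m (p * b - 1) (\<lambda>t. (b * sig_pow (b - 1) (f t)) * f' t)"
      "weighted_diff A S r m (p * b - 1) (\<lambda>t. (b * \<bar>f t\<bar> powr (b - 1)) * f' t)"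
      using weighted_diff_mult[OF weighted_diff_cmult[OF IH[THEN conjunct2]] f'(2), of b]
        weighted_diff_mult[OF weighted_diff_cmult[OF IH[THEN conjunct1]] f'(2), of b]
      unfolding eq .
    moreover have "\<forall>t\<in>S. ((\<lambda>t. \<bar>f t\<bar> powr b) has_real_derivative (b * sig_pow (b - 1) (f t)) * f' t) (at t within {0..})"
      using f' nz by (blast intro: DERIV_chain2[OF has_real_derivative_abs_powr])
    moreover have "\<forall>t\<in>S. ((\<lambda>t. sig_pow b (f t)) has_real_derivative (b * \<bar>f t\<bar> powr (b - 1)) * f' t) (at t within {0..})"
      using f' nz by (blast intro: DERIV_chain2[OF has_real_derivative_sig_pow])
    ultimately show ?case
      using bound
        weighted_diff_SucI[of A "\<lambda>t. \<bar>f t\<bar> powr b" r "p * b" S "\<lambda>t. (b * sig_pow (b - 1) (f t)) * f' t" m]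
        weighted_diff_SucI[of A "\<lambda>t. sig_pow b (f t)" r "p * b" S "\<lambda>t. (b * \<bar>f t\<bar> powr (b - 1)) * f' t" m]
      by (simp del: weighted_diff.simps add: abs_sig_pow)
  }
qed

text \<open>Collects the nested existential derivatives into one sequence, from which the successive
  derivatives can be named.\<close>

lemma weighted_diff_derivs:
  assumes "weighted_diff A S r m q f"
  shows "\<exists>F. F 0 = f \<and> (\<forall>l<m. \<forall>t\<in>S. (F l has_real_derivative F (Suc l) t) (at t within {0..}))"
  using assms
proof (induction m arbitrary: q f)
  case 0 then show ?case by auto
next
  case (Suc m)
  then obtain f' where f': "\<forall>t\<in>S. (f has_real_derivative f' t) (at t within {0..})"
        "weighted_diff A S r m (q - 1) f'"
      by auto
  from Suc.IH[OF f'(2)] obtain F where F: "F 0 = f'"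
    "\<forall>l<m. \<forall>t\<in>S. (F l has_real_derivative F (Suc l) t) (at t within {0..})" by blast
  show ?case
    by (rule exI[of _ "case_nat f F"]) (use F f' in \<open>auto split: nat.split\<close>)
qed

text \<open>Each derivative gained for \<open>f\<close> is fed back through \<open>sig_pow b (f t)\<close> into the equation.\<close>

lemma weighted_diff_solution:
  assumes "\<And>t. t \<in> S \<Longrightarrow> f t \<noteq> 0" and "\<And>t. t \<in> A \<Longrightarrow> \<bar>f t\<bar> = r t powr p"
    and deriv: "\<And>t. t \<in> S \<Longrightarrow> (f has_real_derivative w t - c * sig_pow b (f t)) (at t within {0..})"
    and "p * b = p - 1" and w: "weighted_diff A S r m (p - 1) w"
  shows "weighted_diff A S r (Suc m) p f"
proof -
  have bound: "\<exists>C. \<forall>t\<in>A. \<bar>f t\<bar> \<le> C * r t powr p"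
    using assms(2) by (intro exI[of _ 1]) auto
  have "l \<le> Suc m \<Longrightarrow> weighted_diff A S r l p f" for l
  proof (induction l)
    case 0 show ?case using bound by simp
  next
    case (Suc l)
    have "weighted_diff A S r l (p - 1) (\<lambda>t. sig_pow b (f t))"
      using weighted_diff_powr[of S f A r p l b] assms Suc by simp
    moreover have "weighted_diff A S r l (p - 1) w"
      using w weighted_diff_le Suc.prems by auto
    ultimately have "weighted_diff A S r l (p - 1) (\<lambda>t. w t + (- c) * sig_pow b (f t))"
      by (intro weighted_diff_add weighted_diff_cmult)
    then show ?case using bound deriv by (intro weighted_diff_SucI) auto
  qed
  then show ?thesis by blast
qed

text \<open>
  At a zero \<open>t\<close> of \<open>r\<close>, the bound \<open>\<bar>f s\<bar> \<le> K \<bar>s - t\<bar> powr q\<close> with \<open>q > 1\<close> makes \<open>f\<close> differentiable with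
  derivative \<open>0\<close>, so derivatives are needed only where \<open>r > 0\<close>.
\<close>

lemma weighted_diff_change_weight:
  assumes lip: "\<And>s t. s \<ge> 0 \<Longrightarrow> t \<ge> 0 \<Longrightarrow> r t = 0 \<Longrightarrow> r s \<le> L * \<bar>s - t\<bar>"
    and nonneg: "\<And>t. r t \<ge> 0" 
    and "real m < q" and "weighted_diff {0..} {t. t \<ge> 0 \<and> r t > 0} r m q f"
    and le: "\<And>s. 0 < s \<Longrightarrow> s \<le> q \<Longrightarrow> \<exists>C. \<forall>t\<ge>0. r t powr s \<le> C * r' t powr (s - d)"
  shows "weighted_diff {0..} {0..} r' m (q - d) f"
  using assms(3-)
proof (induction m arbitrary: q f)
  have bound: "\<exists>C. \<forall>t\<in>{0..}. \<bar>f t\<bar> \<le> C * r' t powr (q - d)"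
    if "weighted_diff {0..} {t. t \<ge> 0 \<and> r t > 0} r m q f" 
      "\<exists>C. \<forall>t\<ge>0. r t powr q \<le> C * r' t powr (q - d)" for m q f
  proof -
    from weighted_diff_bound[OF that(1)] that(2) obtain C D where
      C: "\<forall>t\<in>{0..}. \<bar>f t\<bar> \<le> C * r t powr q" and D: "\<forall>t\<ge>0. r t powr q \<le> D * r' t powr (q - d)"
      by blast
    have "\<forall>t\<in>{0..}. \<bar>f t\<bar> \<le> (\<bar>C\<bar> * D) * r' t powr (q - d)"
    proof
      fix t :: real assume "t \<in> {0..}"
      then have "\<bar>f t\<bar> \<le> C * r t powr q" using C by simp
      also have "\<dots> \<le> \<bar>C\<bar> * r t powr q" by (intro mult_right_mono) auto
      also have "\<dots> \<le> \<bar>C\<bar> * (D * r' t powr (q - d))"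
        using D \<open>t \<in> {0..}\<close> by (intro mult_left_mono) auto
      finally show "\<bar>f t\<bar> \<le> (\<bar>C\<bar> * D) * r' t powr (q - d)" by (simp add: mult.assoc)
    qed
    then show ?thesis by blast
  qed
  {
    case 0
    show ?case
      unfolding weighted_diff.simps by (rule bound[OF 0(2) 0(3)[of q]]) (use 0(1) in simp_all)
  next
    case (Suc m)
    obtain f' where f': "\<forall>t\<in>{t. t \<ge> 0 \<and> r t > 0}. (f has_real_derivative f' t) (at t within {0..})"
        "weighted_diff {0..} {t. t \<ge> 0 \<and> r t > 0} r m (q - 1) f'"
      using weighted_diff_SucE[OF Suc.prems(2)] .
    obtain C where C: "\<forall>t\<in>{0..}. \<bar>f t\<bar> \<le> C * r t powr q"
      using weighted_diff_bound[OF Suc.prems(2)] by blast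
    have "(f has_real_derivative f' t) (at t within {0..})" if t: "t \<ge> 0" for t
    proof (cases "r t = 0")
      case False
      then show ?thesis using f' t nonneg[of t] by simp
    next
      case True
      have f0: "f t = 0" using C[rule_format, of t] t True by simp
      obtain D where "\<forall>t\<in>{0..}. \<bar>f' t\<bar> \<le> D * r t powr (q - 1)"
        using weighted_diff_bound[OF f'(2)] by blast
      from this[rule_format, of t] have f'0: "f' t = 0" using t True by simp
      have q: "q > 1" using Suc.prems by simp
      define K where "K = \<bar>C\<bar> * \<bar>L\<bar> powr q"
      have le: "\<bar>f s\<bar> \<le> K * \<bar>s - t\<bar> powr q" if "s \<ge> 0" for s
      proof -
        have "r s \<le> L * \<bar>s - t\<bar>" using lip that t True by blast
        also have "\<dots> \<le> \<bar>L\<bar> * \<bar>s - t\<bar>" by (intro mult_right_mono) auto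
        finally have rs: "r s \<le> \<bar>L\<bar> * \<bar>s - t\<bar>" .
        have "\<bar>f s\<bar> \<le> C * r s powr q" using C that by simp
        also have "\<dots> \<le> \<bar>C\<bar> * r s powr q" by (intro mult_right_mono) auto
        also from rs have "\<dots> \<le> \<bar>C\<bar> * (\<bar>L\<bar> * \<bar>s - t\<bar>) powr q"
          using nonneg q by (intro mult_left_mono powr_mono2) auto
        finally show ?thesis by (simp add: K_def powr_mult mult.assoc)
      qed
      have "((\<lambda>s. K * \<bar>s - t\<bar> powr (q - 1)) \<longlongrightarrow> K * \<bar>t - t\<bar> powr (q - 1)) (at t within {0..})"
        using q by (intro tendsto_intros tendsto_powr') auto
      then have lim: "((\<lambda>s. K * \<bar>s - t\<bar> powr (q - 1)) \<longlongrightarrow> 0) (at t within {0..})"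
        using q by simp
      have "((\<lambda>s. (f s - f t) / (s - t)) \<longlongrightarrow> 0) (at t within {0..})"
      proof (rule Lim_null_comparison[OF _ lim])
        show "\<forall>\<^sub>F s in at t within {0..}. norm ((f s - f t) / (s - t)) \<le> K * \<bar>s - t\<bar> powr (q - 1)"
          unfolding eventually_at_filter
        proof (intro always_eventually allI impI)
          fix s assume s: "s \<noteq> t" "s \<in> {0..}"
          have "\<bar>f s\<bar> / \<bar>s - t\<bar> \<le> (K * \<bar>s - t\<bar> powr q) / \<bar>s - t\<bar>"
            using le s by (intro divide_right_mono) auto
          also have "\<dots> = K * \<bar>s - t\<bar> powr (q - 1)"
            using s by (simp add: powr_diff)
          finally show "norm ((f s - f t) / (s - t)) \<le> K * \<bar>s - t\<bar> powr (q - 1)"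
            by (simp add: f0)
        qed
      qed
      then show ?thesis by (simp add: has_field_derivative_iff f'0)
    qed
    then have "\<forall>t\<in>{0..}. (f has_real_derivative f' t) (at t within {0..})" by simp
    moreover have "weighted_diff {0..} {0..} r' m (q - 1 - d) f'"
    proof (rule Suc.IH[OF _ f'(2)])
      show "real m < q - 1" using Suc.prems(1) by simp
      show "\<exists>C. \<forall>t\<ge>0. r t powr s \<le> C * r' t powr (s - d)" if "0 < s" "s \<le> q - 1" for s
        using Suc.prems(3)[of s] that by simp
    qed
    then have "weighted_diff {0..} {0..} r' m (q - d - 1) f'"
      by (simp only: diff_diff_eq add.commute)
    moreover have "\<exists>C. \<forall>t\<in>{0..}. \<bar>f t\<bar> \<le> C * r' t powr (q - d)"
      by (rule bound[OF Suc.prems(2) Suc.prems(3)[of q]]) (use Suc.prems(1) in simp_all)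
    ultimately show ?case by (intro weighted_diff_SucI)
  }
qed

subsection \<open>Zeros propagate along the cascade\<close>

text \<open>Derivatives are used only to the right of \<open>a\<close>; right continuity at
  \<open>a\<close> lets the comparison start at \<open>a\<close> itself.\<close>

lemma eventually_at_right_mono_ge:
  fixes f :: "real \<Rightarrow> real"
  assumes "continuous (at_right a) f"
    and ev: "\<forall>\<^sub>F t in at_right a. \<exists>d\<ge>0. (f has_real_derivative d) (at t)"
  shows "\<forall>\<^sub>F t in at_right a. f a \<le> f t"
proof -
  obtain b where b: "b > a" "\<And>t. a < t \<Longrightarrow> t < b \<Longrightarrow> \<exists>d\<ge>0. (f has_real_derivative d) (at t)"
    using ev by (auto simp: eventually_at_right[of a "a + 1"])
  have "f a \<le> f t" if t: "a < t" "t < b" for t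
  proof (rule DERIV_nonneg_imp_increasing_open[of a t f])
    have "continuous (at s within {a..t}) f" if "s \<in> {a..t}" for s
    proof (cases "s = a")
      case True
      then show ?thesis
        using assms(1) t by (simp add: continuous_within at_within_Icc_at_right)
    next
      case False
      then show ?thesis
        using b(2)[of s] that t by (auto intro: continuous_at_imp_continuous_at_within DERIV_isCont)
    qed
    then show "continuous_on {a..t} f"
      by (simp add: continuous_on_eq_continuous_within)
  qed (use b t in \<open>auto\<close>, meson b(2) less_trans)
  then show ?thesis
    using b(1) by (auto simp: eventually_at_right[of a "a + 1"] intro!: exI[of _ b])
qed

lemma eventually_at_right_mono_gt:
  fixes f :: "real \<Rightarrow> real"
  assumes "continuous (at_right a) f"
    and ev: "\<forall>\<^sub>F t in at_right a. \<exists>d>0. (f has_real_derivative d) (at t)"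
  shows "\<forall>\<^sub>F t in at_right a. f a < f t"
proof -
  obtain b where b: "b > a" "\<And>t. a < t \<Longrightarrow> t < b \<Longrightarrow> \<exists>d>0. (f has_real_derivative d) (at t)"
    using ev by (auto simp: eventually_at_right[of a "a + 1"])
  have "f a < f t" if t: "a < t" "t < b" for t
  proof (rule DERIV_pos_imp_increasing_open[of a t f])
    have "continuous (at s within {a..t}) f" if "s \<in> {a..t}" for s
    proof (cases "s = a")
      case True
      then show ?thesis
        using assms(1) t by (simp add: continuous_within at_within_Icc_at_right)
    next
      case False
      then show ?thesis
        using b(2)[of s] that t by (auto intro: continuous_at_imp_continuous_at_within DERIV_isCont)
    qed
    then show "continuous_on {a..t} f"
      by (simp add: continuous_on_eq_continuous_within)
  qed (use b t in \<open>auto\<close>, meson b(2) less_trans)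
  then show ?thesis
    using b(1) by (auto simp: eventually_at_right[of a "a + 1"] intro!: exI[of _ b])
qed

text \<open>Dividing by \<open>(t - a) ^ m\<close> leaves a positive power of \<open>t - a\<close>,
  which tends to 0.\<close>

lemma eventually_powr_le_power:
  fixes a c d b :: real
  assumes "c > 0" "b > real m"
  shows "\<forall>\<^sub>F t in at_right a. d * (t - a) powr b \<le> c * (t - a) ^ m"
proof -
  have "((\<lambda>t. d * (t - a) powr (b - real m)) \<longlongrightarrow> d * (a - a) powr (b - real m)) (at_right a)"
    using assms by (intro tendsto_intros tendsto_powr') (auto simp: eventually_at_filter)
  then have "((\<lambda>t. d * (t - a) powr (b - real m)) \<longlongrightarrow> 0) (at_right a)"
    by simp
  then have "\<forall>\<^sub>F t in at_right a. d * (t - a) powr (b - real m) < c"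
    using assms by (intro order_tendstoD) auto
  then show ?thesis
    using eventually_at_right_less
  proof eventually_elim
    case (elim t)
    have "d * (t - a) powr b = d * (t - a) powr (b - real m) * (t - a) ^ m"
      using elim by (simp add: powr_diff powr_realpow)
    also have "\<dots> \<le> c * (t - a) ^ m"
      using elim by (intro mult_right_mono) auto
    finally show ?case .
  qed
qed

lemma has_real_derivative_shifted_power:
  fixes a t c :: real
  shows "((\<lambda>t. c * (t - a) ^ Suc m) has_real_derivative c * (real (Suc m) * (t - a) ^ m)) (at t)"
proof -
  have "((\<lambda>t. t - a) has_real_derivative 1) (at t)" by (auto intro!: derivative_eq_intros)
  from DERIV_cmult[OF DERIV_power_Suc[OF this, of m], of c] show ?thesis by simp
qed

text \<open>
  If \<open>e j a > 0\<close>, then to the right of \<open>a\<close> all \<open>e l\<close> are nonnegative and \<open>O((t - a) ^ (j - l))\<close>. If some \<open>X q a\<close> is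
  nonzero, take the first one: integrating \<open>X l' = X (l + 1) + k l * sig(e l)\<close> downwards from \<open>q\<close>, the term
  \<open>sig(e l)\<close> is of lower order and \<open>X 0\<close> inherits the sign of \<open>X q a\<close>. Otherwise \<open>sig(e (j - 1))\<close>, which is at
  least \<open>c (t - a) powr \<alpha>\<close>, dominates the linear bound on \<open>X j\<close>, and integrating downwards gives \<open>X 0 > 0\<close>.
\<close>

lemma cascade_not_pos:
  fixes e X dX :: "nat \<Rightarrow> real \<Rightarrow> real" and k :: "nat \<Rightarrow> real"
  assumes j: "j \<ge> 1" and k: "\<And>l. l < j \<Longrightarrow> k l > 0"
    and \<alpha>: "real j - 1 < \<alpha> * real j" "\<alpha> < 1"
    and e: "\<And>l. l < j \<Longrightarrow> \<forall>\<^sub>F t in at_right a. (e l has_real_derivative e (Suc l) t - k l * sig_pow \<alpha> (e l t)) (at t)"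
    and e_a: "\<And>l. l < j \<Longrightarrow> (e l has_real_derivative e (Suc l) a - k l * sig_pow \<alpha> (e l a)) (at_right a)"
    and e_cont: "continuous (at_right a) (e j)"
    and X: "\<And>l. l \<le> j \<Longrightarrow> \<forall>\<^sub>F t in at_right a. (X l has_real_derivative dX l t) (at t)"
    and X_a: "\<And>l. l \<le> j \<Longrightarrow> (X l has_real_derivative dX l a) (at_right a)"
    and rec: "\<And>l. l < j \<Longrightarrow> \<forall>\<^sub>F t in at_right a. X (Suc l) t = dX l t - k l * sig_pow \<alpha> (e l t)"
    and X0: "\<forall>\<^sub>F t in at_right a. X 0 t = 0" "X 0 a = 0"
    and zero: "\<And>l. l < j \<Longrightarrow> e l a = 0"
  shows "\<not> e j a > 0"
proof
  assume pos: "e j a > 0"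
  \<comment> \<open>The condition reads \<open>(1 - \<alpha>) * m < 1\<close>, so it passes from
    \<open>j\<close> to every smaller \<open>m\<close>.\<close>
  have \<alpha>_ge: "real m - 1 < \<alpha> * real m" if "m \<le> j" for m
  proof -
    have "(1 - \<alpha>) * real m \<le> (1 - \<alpha>) * real j"
      using that \<alpha> by (intro mult_left_mono) auto
    then show ?thesis using \<alpha> by (simp add: algebra_simps)
  qed
  have "\<alpha> > 0"
    using \<alpha> j by (smt (verit) mult_nonneg_nonneg mult_nonpos_nonneg of_nat_0_le_iff of_nat_1 of_nat_mono)
  have e_c: "continuous (at_right a) (e l)" if "l \<le> j" for l
    using e_cont e_a[of l] that by (cases "l = j") (auto intro: DERIV_continuous)
  have X_c: "continuous (at_right a) (X l)" if "l \<le> j" for l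
    using X_a[of l] that by (auto intro: DERIV_continuous)
  have gt: "\<forall>\<^sub>F t in at_right a. t > a" by (rule eventually_at_right_less)

  \<comment> \<open>Downward induction from \<open>e j\<close>, which is positive near
    \<open>a\<close>: wherever \<open>e l < 0\<close>, both \<open>e (Suc l)\<close> and the damping
    term push \<open>e l\<close> upwards, so it cannot leave 0 downwards.\<close>
  have e_nonneg: "\<forall>\<^sub>F t in at_right a. e l t \<ge> 0" if "l \<le> j" for l
    using that
  proof (induction rule: inc_induct)
    case base
    have "(e j \<longlongrightarrow> e j a) (at_right a)" using e_cont by (simp add: continuous_within)
    then have "\<forall>\<^sub>F t in at_right a. e j t > 0" using pos by (rule order_tendstoD)
    then show ?case by eventually_elim auto
  next
    case (step l)
    have "\<forall>\<^sub>F t in at_right a. e (Suc l) t \<ge> 0 \<and> (e l has_real_derivative e (Suc l) t - k l * sig_pow \<alpha> (e l t)) (at t)"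
      using step e[of l] by (auto simp: eventually_conj_iff)
    then obtain b where b: "b > a" "\<And>t. a < t \<Longrightarrow> t < b \<Longrightarrow> e (Suc l) t \<ge> 0"
      "\<And>t. a < t \<Longrightarrow> t < b \<Longrightarrow> (e l has_real_derivative e (Suc l) t - k l * sig_pow \<alpha> (e l t)) (at t)"
      by (auto simp: eventually_at_right[of a "a + 1"])
    have "- e l t \<le> 0" if t: "a < t" "t < b" for t
    proof (rule nonpos_forward[of a t "\<lambda>t. - e l t"])
      have "continuous (at s within {a..t}) (e l)" if "s \<in> {a..t}" for s
      proof (cases "s = a")
        case True
        then show ?thesis
          using e_c[of l] step t by (simp add: continuous_within at_within_Icc_at_right)
      next
        case False
        then show ?thesis
          using b(3)[of s] that t by (auto intro: continuous_at_imp_continuous_at_within DERIV_isCont)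
      qed
      then show "continuous_on {a..t} (\<lambda>t. - e l t)"
        by (intro continuous_intros) (simp add: continuous_on_eq_continuous_within)
      fix s assume s: "a < s" "s < t" "- e l s > 0"
      have "sig_pow \<alpha> (e l s) \<le> 0"
        using s by (simp add: sig_pow_def sgn_if)
      then have "k l * sig_pow \<alpha> (e l s) \<le> 0"
        using k[of l] step by (simp add: mult_nonneg_nonpos)
      then show "\<exists>d\<le>0. ((\<lambda>t. - e l t) has_real_derivative d) (at s)"
        using b(2)[of s] s t DERIV_minus[OF b(3)[of s]]
        by (intro exI[of _ "- (e (Suc l) s - k l * sig_pow \<alpha> (e l s))"]) auto
    qed (use t zero[of l] step in auto)
    then show ?case
      using b(1) by (auto simp: eventually_at_right[of a "a + 1"] intro!: exI[of _ b])
  qed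

  \<comment> \<open>Any number above \<open>e j a\<close> bounds \<open>e j\<close> close to
    \<open>a\<close>.\<close>
  define C where "C = e j a + 1"
  have "C > 0" using pos by (simp add: C_def)
  have e_le: "\<forall>\<^sub>F t in at_right a. e l t \<le> C * (t - a) ^ (j - l)" if "l \<le> j" for l
    using that
  proof (induction rule: inc_induct)
    case base
    have "(e j \<longlongrightarrow> e j a) (at_right a)" using e_cont by (simp add: continuous_within)
    then have "\<forall>\<^sub>F t in at_right a. e j t < C" by (rule order_tendstoD) (simp add: C_def)
    then show ?case by eventually_elim auto
  next
    case (step l)
    define m where "m = j - Suc l"
    have m: "j - l = Suc m" using step by (simp add: m_def)
    \<comment> \<open>The factor \<open>Suc m\<close> produced by differentiating the power is at
      least 1, and the damping term only lowers \<open>e l\<close>; hence the same \<open>C\<close>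
      serves at every level.\<close>
    let ?f = "\<lambda>t. C * (t - a) ^ Suc m - e l t"
    have "\<forall>\<^sub>F t in at_right a. ?f a \<le> ?f t"
    proof (rule eventually_at_right_mono_ge)
      show "continuous (at_right a) ?f"
        using e_c[of l] step by (auto intro!: continuous_intros)
      show "\<forall>\<^sub>F t in at_right a. \<exists>d\<ge>0. (?f has_real_derivative d) (at t)"
        using step.IH[folded m_def] e[OF \<open>l < j\<close>] e_nonneg[OF less_imp_le[OF \<open>l < j\<close>]] gt
      proof eventually_elim
        case (elim t)
        have "((\<lambda>t. C * (t - a) ^ Suc m) has_real_derivative C * (real (Suc m) * (t - a) ^ m)) (at t)"
          by (rule has_real_derivative_shifted_power)
        from DERIV_diff[OF this elim(2)] 
        have "(?f has_real_derivative C * (real (Suc m) * (t - a) ^ m) - (e (Suc l) t - k l * sig_pow \<alpha> (e l t))) (at t)"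
          by simp
        moreover have "C * (t - a) ^ m \<le> C * (real (Suc m) * (t - a) ^ m)"
          using \<open>C > 0\<close> elim by (intro mult_left_mono) (auto simp: mult_le_cancel_right1)
        moreover have "k l * sig_pow \<alpha> (e l t) \<ge> 0"
          using k[of l] elim step by (simp add: sig_pow_nonneg)
        ultimately show ?case using elim by (intro exI conjI) auto
      qed
    qed
    then show ?case using zero[of l] step by (simp add: m)
  qed

  show False
  proof (cases "\<exists>q\<le>j. X q a \<noteq> 0")
    case True
    define q where "q = (LEAST q. q \<le> j \<and> X q a \<noteq> 0)"
    have "q \<le> j \<and> X q a \<noteq> 0" unfolding q_def by (rule LeastI_ex[OF True])
    moreover have "X l a = 0" if "l < q" for l
      using not_less_Least[of l "\<lambda>q. q \<le> j \<and> X q a \<noteq> 0"] that calculation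
      by (simp flip: q_def)
    ultimately have q: "q \<le> j" "X q a \<noteq> 0" "\<And>l. l < q \<Longrightarrow> X l a = 0" by blast+
    define \<sigma> where "\<sigma> = sgn (X q a)"
    have \<sigma>: "\<bar>\<sigma>\<bar> = 1" "\<sigma> * X q a > 0" using q(2) by (auto simp: \<sigma>_def sgn_if)
    have "\<exists>c>0. \<forall>\<^sub>F t in at_right a. c * (t - a) ^ (q - l) \<le> \<sigma> * X l t" if "l \<le> q" for l
      using that
    proof (induction rule: inc_induct)
      case base
      have "((\<lambda>t. \<sigma> * X q t) \<longlongrightarrow> \<sigma> * X q a) (at_right a)"
        using X_c[OF q(1)] by (auto simp: continuous_within intro!: tendsto_intros)
      then have "\<forall>\<^sub>F t in at_right a. \<sigma> * X q t > \<sigma> * X q a / 2"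
        by (rule order_tendstoD) (use \<sigma> in auto)
      then have "\<forall>\<^sub>F t in at_right a. \<sigma> * X q a / 2 * (t - a) ^ (q - q) \<le> \<sigma> * X q t"
        by eventually_elim auto
      then show ?case using \<sigma> by (intro exI[of _ "\<sigma> * X q a / 2"]) auto
    next
      case (step l)
      define m where "m = q - Suc l"
      have m: "q - l = Suc m" using step by (simp add: m_def)
      have "l < j" using step q by simp
      obtain c where c: "c > 0" "\<forall>\<^sub>F t in at_right a. c * (t - a) ^ m \<le> \<sigma> * X (Suc l) t"
        using step.IH by (auto simp: m_def)
      \<comment> \<open>Half of \<open>c * (t - a) ^ m\<close> absorbs the \<open>sig_pow\<close>
        term; integrating the other half gives the factor \<open>1 / Suc m\<close>.\<close>
      define c' where "c' = c / 2 / real (Suc m)"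
      have "c' > 0" using c by (simp add: c'_def)
      let ?f = "\<lambda>t. \<sigma> * X l t - c' * (t - a) ^ Suc m"
      \<comment> \<open>Because \<open>q \<le> j\<close>, one has
        \<open>\<alpha> * (j - l) > j - l - 1 \<ge> q - l - 1 = m\<close>.\<close>
      have exponent: "real m < \<alpha> * real (j - l)"
        using \<alpha>_ge[of "j - l"] step q by (simp add: m_def of_nat_diff)
      have small: "\<forall>\<^sub>F t in at_right a. (k l * C powr \<alpha>) * (t - a) powr (\<alpha> * real (j - l)) \<le> c / 2 * (t - a) ^ m"
        using c by (intro eventually_powr_le_power[OF _ exponent]) simp
      have "\<forall>\<^sub>F t in at_right a. ?f a \<le> ?f t"
      proof (rule eventually_at_right_mono_ge)
        show "continuous (at_right a) ?f"
          using X_c[of l] \<open>l < j\<close> by (auto intro!: continuous_intros)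
        show "\<forall>\<^sub>F t in at_right a. \<exists>d\<ge>0. (?f has_real_derivative d) (at t)"
          using c(2) X[OF less_imp_le[OF \<open>l < j\<close>]] e_nonneg[OF less_imp_le[OF \<open>l < j\<close>]]
            e_le[OF less_imp_le[OF \<open>l < j\<close>]] rec[OF \<open>l < j\<close>] small gt
        proof eventually_elim
          case (elim t)
          have d: "((\<lambda>t. c' * (t - a) ^ Suc m) has_real_derivative c' * (real (Suc m) * (t - a) ^ m)) (at t)"
            by (rule has_real_derivative_shifted_power)
          have f: "(?f has_real_derivative \<sigma> * dX l t - c' * (real (Suc m) * (t - a) ^ m)) (at t)"
            using DERIV_diff[OF DERIV_cmult[OF elim(2), of \<sigma>] d] by simp
          have "c' * (real (Suc m) * (t - a) ^ m) = c / 2 * (t - a) ^ m"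
          proof -
            have "c' * real (Suc m) = c / 2" by (simp add: c'_def del: of_nat_Suc)
            then show ?thesis by (simp only: mult.assoc[symmetric])
          qed
          moreover have "\<bar>\<sigma> * (k l * sig_pow \<alpha> (e l t))\<bar> \<le> c / 2 * (t - a) ^ m"
          proof -
            have "\<bar>\<sigma> * (k l * sig_pow \<alpha> (e l t))\<bar> = k l * e l t powr \<alpha>"
              using k[OF \<open>l < j\<close>] elim \<sigma> by (simp add: abs_mult abs_sig_pow)
            also have "\<dots> \<le> k l * (C * (t - a) ^ (j - l)) powr \<alpha>"
              using k[OF \<open>l < j\<close>] elim \<open>\<alpha> > 0\<close> by (intro mult_left_mono powr_mono2) auto
            also have "(C * (t - a) ^ (j - l)) powr \<alpha> = C powr \<alpha> * (t - a) powr (\<alpha> * real (j - l))"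
              using \<open>C > 0\<close> elim by (simp add: powr_mult powr_powr mult.commute flip: powr_realpow)
            finally show ?thesis using elim by (simp add: mult.assoc)
          qed
          moreover have "\<sigma> * dX l t = \<sigma> * X (Suc l) t + \<sigma> * (k l * sig_pow \<alpha> (e l t))"
          proof -
            have "dX l t = X (Suc l) t + k l * sig_pow \<alpha> (e l t)" using elim by simp
            then show ?thesis by (simp add: distrib_left)
          qed
          ultimately have "\<sigma> * dX l t - c' * (real (Suc m) * (t - a) ^ m) \<ge> 0"
            using elim(1) by linarith
          then show ?case using f by blast
        qed
      qed
      then have "\<forall>\<^sub>F t in at_right a. c' * (t - a) ^ (q - l) \<le> \<sigma> * X l t"
        using q(3)[of l] step by (simp add: m)
      then show ?case using \<open>c' > 0\<close> by blast
    qed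
    from this[of 0] obtain c where "c > 0" "\<forall>\<^sub>F t in at_right a. c * (t - a) ^ q \<le> \<sigma> * X 0 t"
      by auto
    from this(2) X0(1) gt have "\<forall>\<^sub>F t in at_right a. False"
    proof eventually_elim
      case (elim t)
      have "c * (t - a) ^ q > 0" using elim \<open>c > 0\<close> by simp
      then show ?case using elim by simp
    qed
    then show False by simp
  next
    case False
    then have Xa: "X l a = 0" if "l \<le> j" for l using that by blast
    obtain j' where j': "j = Suc j'" using j by (cases j) auto
    then have "j' < j" by simp
    have "\<forall>\<^sub>F t in at_right a. X l t > 0" if "l \<le> j'" for l
      using that
    proof (induction rule: inc_induct)
      case base
      have "((\<lambda>t. (X j t - X j a) / (t - a)) \<longlongrightarrow> dX j a) (at_right a)"
        using X_a[of j] by (simp add: has_field_derivative_iff)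
      then have X_ge: "\<forall>\<^sub>F t in at_right a. (X j t - X j a) / (t - a) > dX j a - 1"
        by (rule order_tendstoD) auto
      have "((\<lambda>t. (e j' t - e j' a) / (t - a)) \<longlongrightarrow> e j a) (at_right a)"
        using e_a[of j'] zero[of j'] j' by (simp add: has_field_derivative_iff sig_pow_def)
      then have e_ge: "\<forall>\<^sub>F t in at_right a. (e j' t - e j' a) / (t - a) > e j a / 2"
        by (rule order_tendstoD) (use pos in auto)
      \<comment> \<open>Near \<open>a\<close>, \<open>e j'\<close> exceeds half of its slope
        \<open>e j a\<close> times \<open>t - a\<close>, so its damping term is at least
        \<open>c * (t - a) powr \<alpha>\<close>. Meanwhile \<open>X j\<close> is no lower than a
        linear term with coefficient \<open>- (\<bar>dX j a\<bar> + 1)\<close>, and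
        \<open>t - a = (t - a) powr (1 - \<alpha>) * (t - a) powr \<alpha>\<close> makes that term
        negligible.\<close>
      define c where "c = k j' * (e j a / 2) powr \<alpha>"
      have "c > 0" using k[of j'] j' pos by (simp add: c_def)
      have "((\<lambda>t. (\<bar>dX j a\<bar> + 1) * (t - a) powr (1 - \<alpha>)) \<longlongrightarrow> (\<bar>dX j a\<bar> + 1) * (a - a) powr (1 - \<alpha>)) (at_right a)"
        using \<alpha> by (intro tendsto_intros tendsto_powr') (auto simp: eventually_at_filter)
      then have "((\<lambda>t. (\<bar>dX j a\<bar> + 1) * (t - a) powr (1 - \<alpha>)) \<longlongrightarrow> 0) (at_right a)"
        by simp
      then have small: "\<forall>\<^sub>F t in at_right a. (\<bar>dX j a\<bar> + 1) * (t - a) powr (1 - \<alpha>) < c"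
        using \<open>c > 0\<close> by (rule order_tendstoD)
      have "\<forall>\<^sub>F t in at_right a. X j' a < X j' t"
      proof (rule eventually_at_right_mono_gt)
        show "continuous (at_right a) (X j')" using X_c[of j'] j' by simp
        show "\<forall>\<^sub>F t in at_right a. \<exists>d>0. (X j' has_real_derivative d) (at t)"
          using X[OF less_imp_le[OF \<open>j' < j\<close>]] X_ge e_ge small rec[OF \<open>j' < j\<close>] gt
        proof eventually_elim
          case (elim t)
          have Xj: "X j t > (dX j a - 1) * (t - a)"
            using elim Xa[of j] by (simp add: pos_less_divide_eq)
          have ej: "e j' t > e j a / 2 * (t - a)"
            using elim(3,6) zero[of j'] j' by (simp add: pos_less_divide_eq)
          have "e j a / 2 * (t - a) > 0" using pos elim by simp
          have "c * (t - a) powr \<alpha> = k j' * (e j a / 2 * (t - a)) powr \<alpha>"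
            using powr_mult[of "e j a / 2" "t - a" \<alpha>] pos elim(6) by (simp only: c_def mult.assoc)
          also have "\<dots> \<le> k j' * e j' t powr \<alpha>"
            using ej k[of j'] j' \<open>\<alpha> > 0\<close> \<open>e j a / 2 * (t - a) > 0\<close>
            by (intro mult_left_mono powr_mono2) auto
          also have "\<dots> = k j' * sig_pow \<alpha> (e j' t)"
            using ej \<open>e j a / 2 * (t - a) > 0\<close> by (simp add: sig_pow_nonneg)
          finally have s: "c * (t - a) powr \<alpha> \<le> k j' * sig_pow \<alpha> (e j' t)" .
          have "(\<bar>dX j a\<bar> + 1) * (t - a) = (\<bar>dX j a\<bar> + 1) * (t - a) powr (1 - \<alpha>) * (t - a) powr \<alpha>"
            using elim by (simp flip: powr_add)
          also have "\<dots> < c * (t - a) powr \<alpha>"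
            using elim by (intro mult_strict_right_mono) auto
          finally have "(\<bar>dX j a\<bar> + 1) * (t - a) < k j' * sig_pow \<alpha> (e j' t)" using s by simp
          moreover have "(dX j a - 1) * (t - a) \<ge> - ((\<bar>dX j a\<bar> + 1) * (t - a))"
            using elim(6) by (auto simp: minus_mult_left simp del: mult_minus_left intro!: mult_right_mono)
          ultimately have "dX j' t > 0" using Xj elim(5) j' by simp
          then show ?case using elim(1) by blast
        qed
      qed
      then show ?case using Xa[of j'] j' by simp
    next
      case (step l)
      then have "l < j" using j' by simp
      have "\<forall>\<^sub>F t in at_right a. X l a < X l t"
      proof (rule eventually_at_right_mono_gt)
        show "continuous (at_right a) (X l)" using X_c \<open>l < j\<close> by simp
        show "\<forall>\<^sub>F t in at_right a. \<exists>d>0. (X l has_real_derivative d) (at t)"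
          using X[OF less_imp_le[OF \<open>l < j\<close>]] rec[OF \<open>l < j\<close>] e_nonneg[OF less_imp_le[OF \<open>l < j\<close>]]
            step.IH
        proof eventually_elim
          case (elim t)
          have "k l * sig_pow \<alpha> (e l t) \<ge> 0" using k[OF \<open>l < j\<close>] elim by (simp add: sig_pow_nonneg)
          then have "dX l t > 0" using elim by simp
          then show ?case using elim(1) by blast
        qed
      qed
      then show ?case using Xa[of l] \<open>l < j\<close> by simp
    qed
    from this[of 0, simplified] X0(1) have "\<forall>\<^sub>F t in at_right a. False" by eventually_elim simp
    then show False by simp
  qed
qed

text \<open>All equations are odd in \<open>(e, X, dX)\<close>, so the exclusion of a positive
  value, applied to the negated functions, excludes a negative one.\<close>

lemma cascade_zero:
  fixes e X dX :: "nat \<Rightarrow> real \<Rightarrow> real" and k :: "nat \<Rightarrow> real"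
  assumes j: "j \<ge> 1" and k: "\<And>l. l < j \<Longrightarrow> k l > 0"
    and \<alpha>: "real j - 1 < \<alpha> * real j" "\<alpha> < 1"
    and e: "\<And>l. l < j \<Longrightarrow> \<forall>\<^sub>F t in at_right a. (e l has_real_derivative e (Suc l) t - k l * sig_pow \<alpha> (e l t)) (at t)"
    and e_a: "\<And>l. l < j \<Longrightarrow> (e l has_real_derivative e (Suc l) a - k l * sig_pow \<alpha> (e l a)) (at_right a)"
    and e_cont: "continuous (at_right a) (e j)"
    and X: "\<And>l. l \<le> j \<Longrightarrow> \<forall>\<^sub>F t in at_right a. (X l has_real_derivative dX l t) (at t)"
    and X_a: "\<And>l. l \<le> j \<Longrightarrow> (X l has_real_derivative dX l a) (at_right a)"
    and rec: "\<And>l. l < j \<Longrightarrow> \<forall>\<^sub>F t in at_right a. X (Suc l) t = dX l t - k l * sig_pow \<alpha> (e l t)"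
    and X0: "\<forall>\<^sub>F t in at_right a. X 0 t = 0" "X 0 a = 0"
    and zero: "\<And>l. l < j \<Longrightarrow> e l a = 0"
  shows "e j a = 0"
proof -
  have "\<not> e j a > 0"
    by (rule cascade_not_pos[OF assms])
  moreover have "\<not> - e j a > 0"
  proof (rule cascade_not_pos[OF j k \<alpha>, where e = "\<lambda>l t. - e l t" and X = "\<lambda>l t. - X l t" and dX = "\<lambda>l t. - dX l t"])
    show "\<forall>\<^sub>F t in at_right a. ((\<lambda>t. - e l t) has_real_derivative - e (Suc l) t - k l * sig_pow \<alpha> (- e l t)) (at t)"
      if "l < j" for l
      using e[OF that] by eventually_elim (auto simp: sig_pow_minus dest: DERIV_minus)
    show "((\<lambda>t. - e l t) has_real_derivative - e (Suc l) a - k l * sig_pow \<alpha> (- e l a)) (at_right a)"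
      if "l < j" for l
      using DERIV_minus[OF e_a[OF that]] by (simp add: sig_pow_minus)
    show "\<forall>\<^sub>F t in at_right a. ((\<lambda>t. - X l t) has_real_derivative - dX l t) (at t)" if "l \<le> j" for l
      using X[OF that] by eventually_elim (rule DERIV_minus)
    show "\<forall>\<^sub>F t in at_right a. - X (Suc l) t = - dX l t - k l * sig_pow \<alpha> (- e l t)" if "l < j" for l
      using rec[OF that] by eventually_elim (simp add: sig_pow_minus)
    show "\<forall>\<^sub>F t in at_right a. - X 0 t = 0" using X0(1) by simp
  qed (use e_cont X_a X0 zero in \<open>auto intro!: continuous_intros DERIV_minus\<close>)
  ultimately show ?thesis by simp
qed

subsection \<open>Decay and tracking\<close>

lemma DERIV_within_Ici_interior:
  fixes t :: real
  shows "(f has_real_derivative d) (at t within {0..}) \<Longrightarrow> t > 0 \<Longrightarrow> (f has_real_derivative d) (at t)"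
  using at_within_interior[of t "{0..}"] by simp

text \<open>Forward uniqueness of the zero solution is obtained without a Lipschitz condition:
  \<open>y * sig_pow \<alpha> y \<ge> 0\<close> makes \<open>y\<^sup>2\<close>
  nonincreasing.\<close>

lemma sig_pow_decay_zero:
  assumes deriv: "\<And>t. t \<ge> t0 \<Longrightarrow> (y has_real_derivative - c * sig_pow \<alpha> (y t)) (at t within {0..})"
    and "c \<ge> 0" "0 \<le> t0" "y t0 = 0" "t0 \<le> t"
  shows "y t = 0"
proof -
  have "(y t)\<^sup>2 \<le> 0"
  proof (rule nonpos_forward[of t0 t "\<lambda>t. (y t)\<^sup>2"])
    have "continuous_on {t0..} y"
      by (rule DERIV_continuous_on, rule has_field_derivative_subset[OF deriv]) (use assms in auto)
    then show "continuous_on {t0..t} (\<lambda>t. (y t)\<^sup>2)"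
      by (intro continuous_intros) (auto intro: continuous_on_subset)
    fix s assume s: "t0 < s" "s < t"
    have "(y has_real_derivative - c * sig_pow \<alpha> (y s)) (at s)"
      using deriv[of s] s assms by (intro DERIV_within_Ici_interior) auto
    then have "((\<lambda>t. (y t)\<^sup>2) has_real_derivative 2 * y s * (- c * sig_pow \<alpha> (y s))) (at s)"
      by (auto intro!: derivative_eq_intros)
    moreover have "y s * sig_pow \<alpha> (y s) \<ge> 0"
      by (auto simp: sig_pow_def sgn_if mult_nonpos_nonneg)
    then have "2 * y s * (- c * sig_pow \<alpha> (y s)) \<le> 0"
      using \<open>c \<ge> 0\<close> by (simp add: mult.assoc mult.left_commute[of _ c])
    ultimately show "\<exists>d\<le>0. ((\<lambda>t. (y t)\<^sup>2) has_real_derivative d) (at s)" by blast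
  qed (use assms in auto)
  then show ?thesis by simp
qed

text \<open>As long as \<open>y\<close> does not vanish,
  \<open>\<bar>y\<bar> powr (1 - \<alpha>)\<close> falls at the constant rate
  \<open>b = (1 - \<alpha>) * c\<close>; \<open>T\<close> is the time at which this straight line
  reaches 0.\<close>

lemma sig_pow_decay_finite_time:
  assumes deriv: "\<And>t. t \<ge> t0 \<Longrightarrow> (y has_real_derivative - c * sig_pow \<alpha> (y t)) (at t within {0..})"
    and "c > 0" "0 \<le> t0" "\<alpha> < 1"
  shows "\<exists>T\<ge>t0. y T = 0"
proof (rule ccontr)
  assume "\<not> (\<exists>T\<ge>t0. y T = 0)"
  then have nz: "y t \<noteq> 0" if "t \<ge> t0" for t using that by blast
  define b where "b = (1 - \<alpha>) * c"
  have "b > 0" using assms by (simp add: b_def)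
  define T where "T = t0 + \<bar>y t0\<bar> powr (1 - \<alpha>) / b"
  have "t0 \<le> T" using \<open>b > 0\<close> by (simp add: T_def)
  let ?f = "\<lambda>t. \<bar>y t\<bar> powr (1 - \<alpha>) + b * (t - t0)"
  have "?f T \<le> ?f t0"
  proof (rule DERIV_nonpos_imp_decreasing_open[of t0 T ?f])
    have "continuous_on {t0..} y"
      by (rule DERIV_continuous_on, rule has_field_derivative_subset[OF deriv]) (use assms in auto)
    then have "continuous_on {t0..T} y" by (rule continuous_on_subset) auto
    then show "continuous_on {t0..T} ?f"
      by (intro continuous_intros) (use nz in auto)
    fix s assume s: "t0 < s" "s < T"
    have y: "(y has_real_derivative - c * sig_pow \<alpha> (y s)) (at s)"
      using deriv[of s] s assms by (intro DERIV_within_Ici_interior) auto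
    have "((\<lambda>t. \<bar>y t\<bar> powr (1 - \<alpha>)) has_real_derivative
        (1 - \<alpha>) * sig_pow (1 - \<alpha> - 1) (y s) * (- c * sig_pow \<alpha> (y s))) (at s)"
      using DERIV_chain2[OF has_real_derivative_abs_powr y, of "1 - \<alpha>"] nz[of s] s by simp
    moreover have "sig_pow (1 - \<alpha> - 1) (y s) * sig_pow \<alpha> (y s) = 1"
      using nz[of s] s by (auto simp: sig_pow_def sgn_if powr_minus)
    then have "(1 - \<alpha>) * sig_pow (1 - \<alpha> - 1) (y s) * (- c * sig_pow \<alpha> (y s)) = - b"
      by (simp add: b_def mult.assoc mult.left_commute[of _ c])
    ultimately have "((\<lambda>t. \<bar>y t\<bar> powr (1 - \<alpha>)) has_real_derivative - b) (at s)" by simp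
    moreover have "((\<lambda>t. b * (t - t0)) has_real_derivative b) (at s)"
      by (auto intro!: derivative_eq_intros)
    ultimately have "(?f has_real_derivative - b + b) (at s)" by (rule DERIV_add)
    then have "(?f has_real_derivative 0) (at s)" by simp
    then show "\<exists>d. (?f has_real_derivative d) (at s) \<and> d \<le> 0" by blast
  qed (use \<open>t0 \<le> T\<close> in auto)
  then have "\<bar>y T\<bar> powr (1 - \<alpha>) \<le> 0"
    using \<open>b > 0\<close> by (simp add: T_def)
  then show False using nz[of T] \<open>t0 \<le> T\<close> by simp
qed

text \<open>A change of sign would pass through a zero, after which \<open>y\<close> stays
  zero.\<close>

lemma sign_of_persistent_zeros:
  fixes y :: "real \<Rightarrow> real"
  assumes "continuous_on {0..} y" and "\<And>s t. 0 \<le> s \<Longrightarrow> s \<le> t \<Longrightarrow> y s = 0 \<Longrightarrow> y t = 0"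
  shows "(\<forall>t\<ge>0. 0 \<le> y t) \<or> (\<forall>t\<ge>0. y t \<le> 0)"
proof -
  have *: "\<forall>t\<ge>0. 0 \<le> y t" if y: "continuous_on {0..} y" "y 0 \<ge> 0" 
    and z: "\<And>s t. 0 \<le> s \<Longrightarrow> s \<le> t \<Longrightarrow> y s = 0 \<Longrightarrow> y t = 0" for y :: "real \<Rightarrow> real"
  proof (intro allI impI, rule ccontr)
    fix t :: real assume t: "t \<ge> 0" "\<not> 0 \<le> y t"
    have "continuous_on {0..t} y" using y(1) by (rule continuous_on_subset) auto
    then obtain s where "0 \<le> s" "s \<le> t" "y s = 0"
      using IVT2'[of y t 0 0] t y(2) by auto
    then show False using z[of s t] t by simp
  qed
  show ?thesis
  proof (cases "y 0 \<ge> 0")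
    case True
    have "\<forall>t\<ge>0. 0 \<le> y t"
      by (rule *[OF assms(1) True]) (rule assms(2))
    then show ?thesis ..
  next
    case False
    have "\<forall>t\<ge>0. 0 \<le> - y t"
    proof (rule *)
      show "continuous_on {0..} (\<lambda>t. - y t)" using assms(1) by (intro continuous_intros)
      show "- y t = 0" if "0 \<le> s" "s \<le> t" "- y s = 0" for s t
        using assms(2)[of s t] that by simp
    qed (use False in simp)
    then show ?thesis by simp
  qed
qed

lemma bounded_of_eventually_zero:
  fixes y :: "real \<Rightarrow> real"
  assumes "continuous_on {0..} y" and "\<And>t. t \<ge> T \<Longrightarrow> y t = 0"
  obtains K where "K > 0" "\<And>t. t \<ge> 0 \<Longrightarrow> \<bar>y t\<bar> \<le> K"
proof -
  have "compact (y ` {0..T})"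
    by (intro compact_continuous_image continuous_on_subset[OF assms(1)]) auto
  then obtain B where B: "\<And>t. t \<in> {0..T} \<Longrightarrow> \<bar>y t\<bar> \<le> B"
    using compact_imp_bounded[of "y ` {0..T}"] unfolding bounded_iff by (metis imageI real_norm_def)
  have "\<bar>y t\<bar> \<le> \<bar>B\<bar> + 1" if "t \<ge> 0" for t
    using B[of t] assms(2)[of t] that by (cases "t \<le> T") auto
  then show ?thesis by (intro that[of "\<bar>B\<bar> + 1"]) auto
qed

text \<open>
  The function \<open>\<phi> = \<bar>w\<bar> powr (1 / \<alpha>) - L y\<close> is nonpositive for large \<open>L\<close>: if \<open>w \<ge> 0\<close>, it decreases where it is
  positive and is nonpositive at time \<open>0\<close>; if \<open>w \<le> 0\<close>, it increases where it is positive and vanishes at time \<open>T\<close>.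
\<close>

lemma tracking_bound_nonneg:
  fixes y w v :: "real \<Rightarrow> real"
  assumes y: "\<And>t. t \<ge> 0 \<Longrightarrow> (y has_real_derivative w t - c * sig_pow \<alpha> (y t)) (at t within {0..})"
    and w: "\<And>t. t \<ge> 0 \<Longrightarrow> (w has_real_derivative v t) (at t within {0..})"
    and v: "\<And>t. t \<ge> 0 \<Longrightarrow> \<bar>v t\<bar> \<le> C * \<bar>w t\<bar> powr \<alpha>"
    and y_zero: "\<And>s t. 0 \<le> s \<Longrightarrow> s \<le> t \<Longrightarrow> y s = 0 \<Longrightarrow> y t = 0"
    and w_zero: "\<And>s t. 0 \<le> s \<Longrightarrow> s \<le> t \<Longrightarrow> w s = 0 \<Longrightarrow> w t = 0"
    and yw_zero: "\<And>t. 0 \<le> t \<Longrightarrow> y t = 0 \<Longrightarrow> w t = 0"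
    and "0 \<le> T" "y T = 0" and c: "c > 0" and \<alpha>: "0 < \<alpha>" "\<alpha> < 1"
    and y_nonneg: "\<And>t. t \<ge> 0 \<Longrightarrow> y t \<ge> 0"
  shows "\<exists>D. \<forall>t\<ge>0. \<bar>w t\<bar> \<le> D * \<bar>y t\<bar> powr \<alpha>"
proof (cases "y 0 = 0")
  case True
  then have "w t = 0" if "t \<ge> 0" for t using that y_zero[of 0 t] yw_zero[of t] by simp
  then show ?thesis by (intro exI[of _ 0]) auto
next
  case False
  then have y0: "y 0 > 0" using y_nonneg[of 0] by simp
  have y_cont: "continuous_on {0..} y" and w_cont: "continuous_on {0..} w"
    by (rule DERIV_continuous_on[OF y] DERIV_continuous_on[OF w]; simp)+
  have w_T: "w t = 0" if "t \<ge> T" for t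
    using that y_zero[of T t] yw_zero[of t] \<open>0 \<le> T\<close> \<open>y T = 0\<close> by simp
  obtain K where K: "K > 0" "\<And>t. t \<ge> 0 \<Longrightarrow> \<bar>w t\<bar> \<le> K"
    using bounded_of_eventually_zero[OF w_cont w_T] by blast
  define q where "q = 1 / \<alpha>"
  have q: "q > 0" "q * \<alpha> = 1" using \<alpha> by (auto simp: q_def)
  \<comment> \<open>Differentiating \<open>\<bar>w\<bar> powr q\<close> and bounding
    \<open>v\<close> gives a multiple of \<open>\<bar>w\<bar> powr (q - 1 + \<alpha>)\<close>. One
    factor \<open>\<bar>w\<bar>\<close> is kept, and the remaining exponent, being nonnegative, lets
    the rest be bounded through \<open>\<bar>w\<bar> \<le> K\<close>.\<close>
  have "q - 2 + \<alpha> = (1 - \<alpha>)\<^sup>2 / \<alpha>"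
    using \<alpha> by (simp add: q_def field_simps power2_eq_square)
  then have q2: "q - 2 + \<alpha> \<ge> 0" using \<alpha> by simp
  define M where "M = q * \<bar>C\<bar> * K powr (q - 2 + \<alpha>)"
  have "M \<ge> 0" using q by (simp add: M_def)
  \<comment> \<open>One summand per requirement: \<open>2 * M\<close> absorbs the derivative of
    \<open>\<bar>w\<bar> powr q\<close>, \<open>(2 * c) powr q\<close> forces
    \<open>c * y powr \<alpha> \<le> w / 2\<close> where \<open>\<phi> > 0\<close> and
    \<open>w \<ge> 0\<close>, the quotient gives \<open>\<phi> 0 \<le> 0\<close>, and 1 makes
    \<open>L\<close> positive.\<close>
  define L where "L = 2 * M + (2 * c) powr q + \<bar>w 0\<bar> powr q / y 0 + 1"
  have L: "L > 0" "L \<ge> 2 * M" "L \<ge> (2 * c) powr q" "L \<ge> \<bar>w 0\<bar> powr q / y 0"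
    using \<open>M \<ge> 0\<close> y0 by (auto simp: L_def intro!: add_nonneg_pos add_nonneg_nonneg)
  have L\<alpha>: "L powr \<alpha> \<ge> 2 * c"
    using powr_mono2[of \<alpha> "(2 * c) powr q" L] L \<alpha> c q by (simp add: powr_powr)
  define \<phi> where "\<phi> t = \<bar>w t\<bar> powr q - L * y t" for t
  have \<phi>_cont: "continuous_on {0..} \<phi>"
    unfolding \<phi>_def
    by (intro continuous_intros continuous_on_powr' y_cont w_cont) (use q in auto)
  have \<phi>_deriv: "\<exists>d. (\<phi> has_real_derivative d - L * (w t - c * y t powr \<alpha>)) (at t) \<and> \<bar>d\<bar> \<le> M * \<bar>w t\<bar>"
    if t: "t > 0" "w t \<noteq> 0" for t
  proof -
    have wt: "(w has_real_derivative v t) (at t)"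
      using w[of t] t by (intro DERIV_within_Ici_interior) auto
    have yt: "(y has_real_derivative w t - c * y t powr \<alpha>) (at t)"
      using y[of t] t y_nonneg[of t] by (intro DERIV_within_Ici_interior) (auto simp: sig_pow_nonneg)
    define d where "d = q * sig_pow (q - 1) (w t) * v t"
    have "((\<lambda>t. \<bar>w t\<bar> powr q) has_real_derivative d) (at t)"
      unfolding d_def using DERIV_chain2[OF has_real_derivative_abs_powr wt] t by blast
    from DERIV_diff[OF this DERIV_cmult[OF yt, of L]]
    have "(\<phi> has_real_derivative d - L * (w t - c * y t powr \<alpha>)) (at t)"
      by (simp add: \<phi>_def [abs_def])
    moreover have "\<bar>d\<bar> \<le> M * \<bar>w t\<bar>"
    proof -
      have "\<bar>d\<bar> = q * \<bar>w t\<bar> powr (q - 1) * \<bar>v t\<bar>"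
        using q by (simp add: d_def abs_mult abs_sig_pow)
      also have "\<dots> \<le> q * \<bar>w t\<bar> powr (q - 1) * (\<bar>C\<bar> * \<bar>w t\<bar> powr \<alpha>)"
      proof -
        have "\<bar>v t\<bar> \<le> \<bar>C\<bar> * \<bar>w t\<bar> powr \<alpha>"
          using v[of t] t by (smt (verit) mult_right_mono powr_ge_zero)
        then show ?thesis using q by (intro mult_left_mono) auto
      qed
      also have "\<dots> = q * \<bar>C\<bar> * (\<bar>w t\<bar> powr (q - 2 + \<alpha>) * \<bar>w t\<bar>)"
      proof -
        have "\<bar>w t\<bar> powr (q - 1) * \<bar>w t\<bar> powr \<alpha> = \<bar>w t\<bar> powr ((q - 2 + \<alpha>) + 1)"
          by (simp flip: powr_add add: algebra_simps)
        also have "\<dots> = \<bar>w t\<bar> powr (q - 2 + \<alpha>) * \<bar>w t\<bar>"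
          by (subst powr_add) simp
        finally show ?thesis by (simp add: mult_ac)
      qed
      also have "\<dots> \<le> q * \<bar>C\<bar> * (K powr (q - 2 + \<alpha>) * \<bar>w t\<bar>)"
        using q q2 K t by (intro mult_left_mono mult_right_mono powr_mono2) auto
      finally show ?thesis by (simp add: M_def mult.assoc)
    qed
    ultimately show ?thesis by blast
  qed
  have \<phi>_le: "\<phi> t \<le> 0" if "t \<ge> 0" for t
    using sign_of_persistent_zeros[OF w_cont w_zero]
  proof
    assume w_nonneg: "\<forall>t\<ge>0. 0 \<le> w t"
    show ?thesis
    proof (rule nonpos_forward[of 0 t \<phi>])
      show "\<phi> 0 \<le> 0" using L(4) y0 by (simp add: \<phi>_def pos_divide_le_eq)
      fix s assume s: "0 < s" "s < t" "\<phi> s > 0"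
      have "L * y s < w s powr q" "L * y s \<ge> 0"
        using s w_nonneg y_nonneg[of s] L(1) by (auto simp: \<phi>_def)
      then have "(L * y s) powr \<alpha> < (w s powr q) powr \<alpha>"
        using \<alpha> by (intro powr_less_mono2) auto
      then have "L powr \<alpha> * y s powr \<alpha> < w s"
        using s w_nonneg L(1) y_nonneg[of s] q by (simp add: powr_mult powr_powr)
      moreover have "2 * c * y s powr \<alpha> \<le> L powr \<alpha> * y s powr \<alpha>"
        using L\<alpha> by (intro mult_right_mono) auto
      ultimately have half: "c * y s powr \<alpha> \<le> w s / 2" by simp
      have "w s \<noteq> 0" using \<open>L * y s < w s powr q\<close> \<open>L * y s \<ge> 0\<close> by auto
      from \<phi>_deriv[OF s(1) this] obtain d where
        d: "(\<phi> has_real_derivative d - L * (w s - c * y s powr \<alpha>)) (at s)" "\<bar>d\<bar> \<le> M * \<bar>w s\<bar>" by blast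
      have "M * w s \<le> L / 2 * w s" using L(2) w_nonneg s by (intro mult_right_mono) auto
      moreover have "L * (w s / 2) \<le> L * (w s - c * y s powr \<alpha>)"
        using half L(1) by (intro mult_left_mono) auto
      ultimately have "d - L * (w s - c * y s powr \<alpha>) \<le> 0" using d(2) w_nonneg s by auto
      then show "\<exists>d\<le>0. (\<phi> has_real_derivative d) (at s)" using d(1) by blast
    qed (use that \<phi>_cont in \<open>auto intro: continuous_on_subset\<close>)
  next
    assume w_nonpos: "\<forall>t\<ge>0. w t \<le> 0"
    show ?thesis
    proof (rule nonpos_backward[of t "max t T" \<phi>])
      show "\<phi> (max t T) \<le> 0"
        using w_T[of "max t T"] y_nonneg[of "max t T"] L(1) that by (simp add: \<phi>_def)
      fix s assume s: "t < s" "s < max t T" "\<phi> s > 0"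
      then have "s > 0" using that by simp
      have "w s \<noteq> 0" using s(3) y_nonneg[of s] L(1) \<open>s > 0\<close> by (auto simp: \<phi>_def mult_less_0_iff)
      from \<phi>_deriv[OF \<open>s > 0\<close> this] obtain d where
        d: "(\<phi> has_real_derivative d - L * (w s - c * y s powr \<alpha>)) (at s)" "\<bar>d\<bar> \<le> M * \<bar>w s\<bar>" by blast
      have "M * \<bar>w s\<bar> \<le> L * \<bar>w s\<bar>" using L(2) \<open>M \<ge> 0\<close> by (intro mult_right_mono) auto
      moreover have "L * (c * y s powr \<alpha>) \<ge> 0" using L(1) c by simp
      moreover have "L * (w s - c * y s powr \<alpha>) = - (L * \<bar>w s\<bar>) - L * (c * y s powr \<alpha>)"
        using w_nonpos \<open>s > 0\<close> by (simp add: algebra_simps)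
      ultimately have "d - L * (w s - c * y s powr \<alpha>) \<ge> 0" using d(2) by linarith
      then show "\<exists>d\<ge>0. (\<phi> has_real_derivative d) (at s)" using d(1) by blast
    qed (use that \<phi>_cont in \<open>auto intro: continuous_on_subset\<close>)
  qed
  have "\<bar>w t\<bar> \<le> L powr \<alpha> * \<bar>y t\<bar> powr \<alpha>" if "t \<ge> 0" for t
  proof -
    have "\<bar>w t\<bar> powr q \<le> L * y t" using \<phi>_le[OF that] by (simp add: \<phi>_def)
    then have "(\<bar>w t\<bar> powr q) powr \<alpha> \<le> (L * y t) powr \<alpha>"
      using \<alpha> by (intro powr_mono2) auto
    then show ?thesis
      using L(1) y_nonneg[OF that] q by (simp add: powr_mult powr_powr)
  qed
  then show ?thesis by blast
qed

text \<open>Since zeros of \<open>y\<close> persist, \<open>y\<close> has a constant sign;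
  reflecting \<open>y\<close>, \<open>w\<close> and \<open>v\<close> handles the nonpositive
  case.\<close>

lemma tracking_bound:
  fixes y w v :: "real \<Rightarrow> real"
  assumes y: "\<And>t. t \<ge> 0 \<Longrightarrow> (y has_real_derivative w t - c * sig_pow \<alpha> (y t)) (at t within {0..})"
    and w: "\<And>t. t \<ge> 0 \<Longrightarrow> (w has_real_derivative v t) (at t within {0..})"
    and v: "\<And>t. t \<ge> 0 \<Longrightarrow> \<bar>v t\<bar> \<le> C * \<bar>w t\<bar> powr \<alpha>"
    and y_zero: "\<And>s t. 0 \<le> s \<Longrightarrow> s \<le> t \<Longrightarrow> y s = 0 \<Longrightarrow> y t = 0"
    and w_zero: "\<And>s t. 0 \<le> s \<Longrightarrow> s \<le> t \<Longrightarrow> w s = 0 \<Longrightarrow> w t = 0"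
    and yw_zero: "\<And>t. 0 \<le> t \<Longrightarrow> y t = 0 \<Longrightarrow> w t = 0"
    and "0 \<le> T" "y T = 0" and c: "c > 0" and \<alpha>: "0 < \<alpha>" "\<alpha> < 1"
  shows "\<exists>D. \<forall>t\<ge>0. \<bar>w t\<bar> \<le> D * \<bar>y t\<bar> powr \<alpha>"
proof -
  have "continuous_on {0..} y"
    by (rule DERIV_continuous_on[OF y]) simp
  from sign_of_persistent_zeros[OF this y_zero] show ?thesis
  proof
    assume "\<forall>t\<ge>0. 0 \<le> y t"
    then show ?thesis
      by (intro tracking_bound_nonneg[OF assms]) auto
  next
    assume "\<forall>t\<ge>0. y t \<le> 0"
    then have "\<exists>D. \<forall>t\<ge>0. \<bar>- w t\<bar> \<le> D * \<bar>- y t\<bar> powr \<alpha>"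
    proof (intro tracking_bound_nonneg[of "\<lambda>t. - y t" "\<lambda>t. - w t" c \<alpha> "\<lambda>t. - v t" C T])
      show "((\<lambda>t. - y t) has_real_derivative - w t - c * sig_pow \<alpha> (- y t)) (at t within {0..})"
        if "t \<ge> 0" for t
        using DERIV_minus[OF y[OF that]] by (simp add: sig_pow_minus)
      show "((\<lambda>t. - w t) has_real_derivative - v t) (at t within {0..})" if "t \<ge> 0" for t
        using DERIV_minus[OF w[OF that]] .
      show "- y t = 0" if "0 \<le> s" "s \<le> t" "- y s = 0" for s t
        using y_zero[of s t] that by simp
      show "- w t = 0" if "0 \<le> s" "s \<le> t" "- w s = 0" for s t
        using w_zero[of s t] that by simp
      show "- w t = 0" if "0 \<le> t" "- y t = 0" for t
        using yw_zero[of t] that by simp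
    qed (use assms(7-11) v in auto)
    then show ?thesis by simp
  qed
qed

text \<open>Where \<open>y\<close> is nonzero, the factor
  \<open>\<bar>y\<bar> powr (- \<alpha>)\<close> from the chain rule cancels the growth of
  \<open>d\<close>, so \<open>\<bar>y\<bar> powr (1 - \<alpha>)\<close> has slope at most
  \<open>(1 - \<alpha>) * B\<close>. Before the zero \<open>t\<close> this is integrated backwards
  from \<open>t\<close>; after it \<open>y\<close> vanishes.\<close>

lemma tracking_radius_lipschitz:
  fixes y d :: "real \<Rightarrow> real"
  assumes y: "\<And>t. t \<ge> 0 \<Longrightarrow> (y has_real_derivative d t) (at t within {0..})"
    and d: "\<And>t. t \<ge> 0 \<Longrightarrow> \<bar>d t\<bar> \<le> B * \<bar>y t\<bar> powr \<alpha>"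
    and y_zero: "\<And>s t. 0 \<le> s \<Longrightarrow> s \<le> t \<Longrightarrow> y s = 0 \<Longrightarrow> y t = 0"
    and "B \<ge> 0" "\<alpha> < 1" "s \<ge> 0" "t \<ge> 0" "y t = 0"
  shows "\<bar>y s\<bar> powr (1 - \<alpha>) \<le> (1 - \<alpha>) * B * \<bar>s - t\<bar>"
proof (cases "s \<le> t")
  case False
  then have "y s = 0" using \<open>t \<ge> 0\<close> \<open>y t = 0\<close> by (intro y_zero[of t s]) auto
  then show ?thesis using \<open>B \<ge> 0\<close> \<open>\<alpha> < 1\<close> by simp
next
  case True
  have y_cont: "continuous_on {0..} y"
    by (rule DERIV_continuous_on[OF y]) simp
  let ?f = "\<lambda>\<tau>. \<bar>y \<tau>\<bar> powr (1 - \<alpha>) - (1 - \<alpha>) * B * (t - \<tau>)"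
  have "?f s \<le> 0"
  proof (rule nonpos_backward[of s t ?f])
    have "continuous_on {s..t} y"
      using y_cont by (rule continuous_on_subset) (use \<open>s \<ge> 0\<close> in auto)
    then show "continuous_on {s..t} ?f"
      by (intro continuous_intros continuous_on_powr') (use \<open>\<alpha> < 1\<close> in auto)
    fix \<tau> assume \<tau>: "s < \<tau>" "\<tau> < t" "?f \<tau> > 0"
    have "(1 - \<alpha>) * B * (t - \<tau>) \<ge> 0"
      using \<open>\<alpha> < 1\<close> \<open>B \<ge> 0\<close> \<tau> by (intro mult_nonneg_nonneg) auto
    then have nz: "y \<tau> \<noteq> 0" using \<tau>(3) by auto
    have "(y has_real_derivative d \<tau>) (at \<tau>)"
      using y[of \<tau>] \<tau> \<open>s \<ge> 0\<close> by (intro DERIV_within_Ici_interior) auto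
    from DERIV_chain2[OF has_real_derivative_abs_powr[OF nz] this, of "1 - \<alpha>"]
    have "((\<lambda>\<tau>. \<bar>y \<tau>\<bar> powr (1 - \<alpha>)) has_real_derivative (1 - \<alpha>) * sig_pow (1 - \<alpha> - 1) (y \<tau>) * d \<tau>) (at \<tau>)" .
    moreover have "((\<lambda>\<tau>. (1 - \<alpha>) * B * (t - \<tau>)) has_real_derivative - ((1 - \<alpha>) * B)) (at \<tau>)"
      by (auto intro!: derivative_eq_intros)
    ultimately have "(?f has_real_derivative (1 - \<alpha>) * sig_pow (1 - \<alpha> - 1) (y \<tau>) * d \<tau> - - ((1 - \<alpha>) * B)) (at \<tau>)"
      by (rule DERIV_diff)
    then have "(?f has_real_derivative (1 - \<alpha>) * sig_pow (1 - \<alpha> - 1) (y \<tau>) * d \<tau> + (1 - \<alpha>) * B) (at \<tau>)"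
      by simp
    moreover have "\<bar>(1 - \<alpha>) * sig_pow (1 - \<alpha> - 1) (y \<tau>) * d \<tau>\<bar> \<le> (1 - \<alpha>) * B"
    proof -
      have "\<bar>sig_pow (1 - \<alpha> - 1) (y \<tau>) * d \<tau>\<bar> \<le> \<bar>y \<tau>\<bar> powr (- \<alpha>) * (B * \<bar>y \<tau>\<bar> powr \<alpha>)"
        using d[of \<tau>] \<tau> \<open>s \<ge> 0\<close> by (auto simp: abs_mult abs_sig_pow intro!: mult_left_mono)
      also have "\<dots> = B" using nz by (simp add: powr_minus)
      finally show ?thesis
        using \<open>\<alpha> < 1\<close> by (simp add: abs_mult mult.assoc mult_left_mono)
    qed
    ultimately show "\<exists>d\<ge>0. (?f has_real_derivative d) (at \<tau>)"
      by (intro exI[of _ "(1 - \<alpha>) * sig_pow (1 - \<alpha> - 1) (y \<tau>) * d \<tau> + (1 - \<alpha>) * B"]) auto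
  qed (use True \<open>y t = 0\<close> in auto)
  then show ?thesis using True by (simp add: abs_of_nonpos)
qed

subsection \<open>The closed loop\<close>

lemma exponent_bounds:
  fixes \<alpha> :: real
  assumes "n \<ge> 1" "(real n - 1) / real n < \<alpha>" "\<alpha> < 1"
  shows "0 < \<alpha>" and "real n < 1 / (1 - \<alpha>)"
proof -
  have "0 \<le> (real n - 1) / real n" using assms(1) by simp
  then show "0 < \<alpha>" using assms(2) by simp
  have "real n - 1 < \<alpha> * real n" using assms by (simp add: pos_divide_less_eq)
  then show "real n < 1 / (1 - \<alpha>)" using assms(3) by (simp add: pos_less_divide_eq algebra_simps)
qed

lemma powr_le_const_mult:
  fixes a b :: real
  assumes "0 \<le> a" "a \<le> R" "s \<ge> 0"
  shows "a powr (b + s) \<le> R powr s * a powr b"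
proof -
  have "a powr (b + s) = a powr s * a powr b" by (simp add: powr_add)
  also have "\<dots> \<le> R powr s * a powr b"
    using assms by (intro mult_right_mono powr_mono2) auto
  finally show ?thesis .
qed

text \<open>For the constant weight 1 the degree carries no information, so it may be reset after
  each differentiation.\<close>

lemma weighted_diff_one_exponent:
  "weighted_diff A S (\<lambda>_. 1) m q f \<Longrightarrow> weighted_diff A S (\<lambda>_. 1) m q' f"
proof (induction m arbitrary: q q' f)
  case 0
  then show ?case by simp
next
  case (Suc m)
  obtain f' where f': "\<forall>t\<in>S. (f has_real_derivative f' t) (at t within {0..})"
    "weighted_diff A S (\<lambda>_. 1) m (q - 1) f'"
    using Suc.prems by (rule weighted_diff_SucE)
  show ?case
    using weighted_diff_bound[OF Suc.prems] Suc.IH[OF f'(2)] by (intro weighted_diff_SucI[OF _ f'(1)]) simp_all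
qed

locale closed_loop =
  fixes n :: nat and a k :: "nat \<Rightarrow> real" and \<alpha> x1d :: real
    and x xd dxd :: "real \<Rightarrow> nat \<Rightarrow> real" and u :: "real \<Rightarrow> real"
  assumes n: "n \<ge> 1"
    and k_pos: "i \<in> {1..n} \<Longrightarrow> k i > 0"
    and \<alpha>_gt: "(real n - 1) / real n < \<alpha>" and \<alpha>_less: "\<alpha> < 1"
    and trajectory: "canonical_form_trajectory n a u x"
    and reference: "reference_recursion n k \<alpha> x1d x xd dxd"
    and control: "control_law n a k \<alpha> x xd dxd u"
begin

text \<open>Setting \<open>err (Suc n) = 0\<close> gives the last error equation the same form as the others.\<close>

definition err :: "nat \<Rightarrow> real \<Rightarrow> real" where
  "err i t = (if i \<le> n then x t i - xd t i else 0)"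

text \<open>These are the weights \<open>r\<^sub>i\<close> of the introduction, with
  \<open>1 - \<alpha> = 1 / p\<close>; \<open>p\<close> itself is \<open>homdeg\<close>.\<close>

definition radius :: "nat \<Rightarrow> real \<Rightarrow> real" where
  "radius i t = \<bar>err i t\<bar> powr (1 - \<alpha>)"

definition homdeg :: real where
  "homdeg = 1 / (1 - \<alpha>)"

lemma \<alpha>_pos: "0 < \<alpha>" and homdeg_gt: "real n < homdeg"
  using exponent_bounds[OF n \<alpha>_gt \<alpha>_less] by (auto simp: homdeg_def)

lemma homdeg_\<alpha>: "homdeg * \<alpha> = homdeg - 1" and homdeg_mult: "(1 - \<alpha>) * homdeg = 1"
  using \<alpha>_less by (auto simp: homdeg_def field_simps)

lemma x_deriv:
  assumes "1 \<le> i" "i < n" "t \<ge> 0"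
  shows "((\<lambda>s. x s i) has_real_derivative x t (Suc i)) (at t within {0..})"
  using trajectory assms by (simp add: canonical_form_trajectory_def)

lemma xd_1: "t \<ge> 0 \<Longrightarrow> xd t 1 = x1d" and dxd_1: "t \<ge> 0 \<Longrightarrow> dxd t 1 = 0"
  using reference by (simp_all add: reference_recursion_def)

lemma xd_deriv:
  assumes "1 \<le> i" "i \<le> n" "t \<ge> 0"
  shows "((\<lambda>s. xd s i) has_real_derivative dxd t i) (at t within {0..})"
  using reference assms by (simp add: reference_recursion_def)

lemma xd_Suc:
  assumes "1 \<le> i" "i < n" "t \<ge> 0"
  shows "xd t (Suc i) = dxd t i - k i * sig_pow \<alpha> (err i t)"
  using reference assms by (simp add: reference_recursion_def err_def)

lemma x_n_deriv:
  assumes "t \<ge> 0"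
  shows "((\<lambda>s. x s n) has_real_derivative dxd t n - k n * sig_pow \<alpha> (err n t)) (at t within {0..})"
proof -
  have "(\<Sum>i=1..n. a i * x t i) + u t = dxd t n - k n * sig_pow \<alpha> (err n t)"
    using control assms by (simp add: control_law_def err_def)
  then show ?thesis
    using trajectory assms unfolding canonical_form_trajectory_def by metis
qed

lemma err_deriv:
  assumes "1 \<le> i" "i \<le> n" "t \<ge> 0"
  shows "(err i has_real_derivative err (Suc i) t - k i * sig_pow \<alpha> (err i t)) (at t within {0..})"
proof -
  have "(err i has_real_derivative (if i < n then x t (Suc i) else dxd t n - k n * sig_pow \<alpha> (err n t)) - dxd t i) (at t within {0..})"
    using DERIV_diff[OF x_deriv xd_deriv[OF assms]] DERIV_diff[OF x_n_deriv xd_deriv[OF assms]] assms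
    by (auto simp: err_def[abs_def])
  then show ?thesis
    using assms xd_Suc[of i t] by (auto simp: err_def split: if_splits)
qed

lemma err_cont: "1 \<le> i \<Longrightarrow> i \<le> n \<Longrightarrow> continuous_on {0..} (err i)"
  by (rule DERIV_continuous_on[OF err_deriv]) auto

text \<open>Regularity without bounds, as the first set is empty. The chain of integrators gives
  \<open>x l\<close> exactly \<open>n - l + 1\<close> derivatives to work with, and away from zeros
  of \<open>err l\<close> the signed power is as smooth as \<open>err l\<close>. Each recursion step
  therefore costs one derivative, starting from a constant.\<close>

lemma xd_weighted_diff:
  assumes "1 \<le> l" "l \<le> i" "i \<le> n"
  shows "weighted_diff {} {t. t \<ge> 0 \<and> (\<forall>j\<in>{1..<i}. err j t \<noteq> 0)} (\<lambda>_. 1) (n - l + 2) 0 (\<lambda>t. xd t l)"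
    (is "weighted_diff {} ?S _ _ _ _")
proof -
  let ?D = "weighted_diff {} ?S (\<lambda>_. 1)"
  \<comment> \<open>By continuity of the errors, \<open>?S\<close> is relatively open in the half
    line.\<close>
  have op: "\<forall>\<^sub>F s in at t within {0..}. s \<in> ?S" if "t \<in> ?S" for t
  proof -
    have "\<forall>\<^sub>F s in at t within {0..}. err j s \<noteq> 0" if "j \<in> {1..<i}" for j
    proof -
      have "(err j \<longlongrightarrow> err j t) (at t within {0..})"
        using err_cont[of j] that \<open>t \<in> ?S\<close> assms by (auto simp: continuous_on)
      then show ?thesis
        by (rule tendsto_imp_eventually_ne) (use that \<open>t \<in> ?S\<close> in auto)
    qed
    then have "\<forall>\<^sub>F s in at t within {0..}. \<forall>j\<in>{1..<i}. err j s \<noteq> 0"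
      by (intro eventually_ball_finite) auto
    moreover have "\<forall>\<^sub>F s in at t within {0..}. s \<in> {0..}"
      by (simp add: eventually_at_filter)
    ultimately show ?thesis by eventually_elim auto
  qed
  have x: "weighted_diff {} {0..} (\<lambda>_. 1) (n - l + 1) 0 (\<lambda>t. x t l)" if "1 \<le> l" "l \<le> n" for l
    using that(2,1)
  proof (induction rule: inc_induct)
    case base
    have "weighted_diff {} {0..} (\<lambda>_. 1) (Suc 0) 0 (\<lambda>t. x t n)"
      by (rule weighted_diff_SucI[where f' = "\<lambda>t. dxd t n - k n * sig_pow \<alpha> (err n t)"])
         (use x_n_deriv in auto)
    then show ?case by simp
  next
    case (step l)
    then have "weighted_diff {} {0..} (\<lambda>_. 1) (n - l) (0 - 1) (\<lambda>t. x t (Suc l))"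
      using weighted_diff_one_exponent by (simp add: Suc_diff_Suc)
    then have "weighted_diff {} {0..} (\<lambda>_. 1) (Suc (n - l)) 0 (\<lambda>t. x t l)"
      by (rule weighted_diff_SucI[rotated 2]) (use x_deriv[of l] step in auto)
    then show ?case by simp
  qed
  show ?thesis
    using assms(1,2)
  proof (induction rule: dec_induct)
    case base
    have "?D (n - 1 + 2) 0 (\<lambda>t. xd t 1)"
      by (rule weighted_diff_cong[OF _ _ op weighted_diff_const[of "{}" x1d]]) (use xd_1 in auto)
    then show ?case .
  next
    case (step l)
    have l: "n - l + 1 = n - Suc l + 2" using step assms by simp
    have IH: "?D (n - l + 2) 0 (\<lambda>t. xd t l)"
      by (rule step.IH) (use step.prems in simp)
    have "?D (n - l + 1) (0 - 1) (\<lambda>t. dxd t l)"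
    proof (rule weighted_diff_derivative[OF _ _ op])
      show "?D (Suc (n - l + 1)) 0 (\<lambda>t. xd t l)" using IH by (simp only: add_2_eq_Suc' add_Suc_right add_0_right One_nat_def)
      show "((\<lambda>t. xd t l) has_real_derivative dxd t l) (at t within {0..})" if "t \<in> ?S" for t
        using that step.hyps step.prems assms by (intro xd_deriv) auto
    qed auto
    then have dxd: "?D (n - l + 1) 0 (\<lambda>t. dxd t l)"
      by (rule weighted_diff_one_exponent)
    have "?D (n - l + 1) 0 (\<lambda>t. x t l)"
      by (rule weighted_diff_subset[OF _ x]) (use step assms in auto)
    moreover have "?D (n - l + 1) 0 (\<lambda>t. xd t l)"
      by (rule weighted_diff_le[OF _ IH]) simp
    ultimately have "?D (n - l + 1) 0 (\<lambda>t. x t l + (- 1) * xd t l)"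
      by (intro weighted_diff_add weighted_diff_cmult)
    then have "?D (n - l + 1) 0 (err l)"
      using step assms by (simp add: err_def[abs_def])
    then have "?D (n - l + 1) (0 * \<alpha>) (\<lambda>t. sig_pow \<alpha> (err l t))"
      by (intro weighted_diff_powr[THEN conjunct2]) (use step.hyps step.prems in auto)
    then have "?D (n - l + 1) 0 (\<lambda>t. sig_pow \<alpha> (err l t))"
      by (simp only: mult_zero_left)
    then have "?D (n - l + 1) 0 (\<lambda>t. dxd t l + (- k l) * sig_pow \<alpha> (err l t))"
      by (intro weighted_diff_add weighted_diff_cmult dxd)
    then have "?D (n - l + 1) 0 (\<lambda>t. xd t (Suc l))"
      by (rule weighted_diff_cong[OF _ _ op, rotated -1]) (use xd_Suc[of l] step assms in auto)
    then show ?case unfolding l .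
  qed
qed

text \<open>
  Let \<open>i\<close> be the first index with \<open>err i t = 0\<close>. Near \<open>t\<close> the function \<open>x\<^sub>i\<^sup>d\<close> has enough derivatives \<open>F l\<close>, and
  subtracting \<open>F l\<close> from \<open>x\<^sub>i\<^sub>+\<^sub>l\<^sup>d\<close> leaves a recursion that starts from \<open>0\<close>.
\<close>

lemma err_zero_step:
  "1 \<le> j \<Longrightarrow> j < n \<Longrightarrow> 0 \<le> t \<Longrightarrow> err j t = 0 \<Longrightarrow> err (Suc j) t = 0"
proof (induction j arbitrary: t rule: less_induct)
  case (less j)
  define i where "i = (LEAST i. 1 \<le> i \<and> err i t = 0)"
  have "1 \<le> i \<and> err i t = 0"
    unfolding i_def by (rule LeastI[of _ j]) (use less.prems in auto)
  then have i: "1 \<le> i" "err i t = 0" by auto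
  have "i \<le> j" unfolding i_def by (rule Least_le) (use less.prems in auto)
  have before: "err l t \<noteq> 0" if "1 \<le> l" "l < i" for l
    using not_less_Least[of l "\<lambda>i. 1 \<le> i \<and> err i t = 0"] that unfolding i_def by auto
  \<comment> \<open>The induction hypothesis at indices below \<open>j\<close> carries the zero at
    \<open>i\<close> up to \<open>j\<close>.\<close>
  have block: "err l t = 0" if "i \<le> l" "l \<le> j" for l
    using that
  proof (induction rule: dec_induct)
    case base
    then show ?case using i by simp
  next
    case (step l)
    then show ?case using less.IH[of l t] less.prems i by simp
  qed
  let ?S = "{s. s \<ge> 0 \<and> (\<forall>l\<in>{1..<i}. err l s \<noteq> 0)}"
  obtain F where F0: "F 0 = (\<lambda>t. xd t i)"
    and F: "\<And>l s. l < n - i + 2 \<Longrightarrow> s \<in> ?S \<Longrightarrow> (F l has_real_derivative F (Suc l) s) (at s within {0..})"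
    using weighted_diff_derivs[OF xd_weighted_diff[of i i]] i \<open>i \<le> j\<close> less.prems by auto
  \<comment> \<open>\<open>m\<close> is the length of the block of vanishing errors. As
    \<open>j < n\<close>, it is at most \<open>n - i\<close>, so \<open>F l\<close> is
    differentiable for every \<open>l \<le> m\<close>.\<close>
  define m where "m = Suc j - i"
  have m: "m \<ge> 1" "i + m = Suc j" using \<open>i \<le> j\<close> by (auto simp: m_def)
  have tS: "t \<in> ?S" using less.prems before by auto
  have le: "at_right t \<le> at t within {0..}"
    using less.prems by (intro at_le) auto
  have ev: "\<forall>\<^sub>F s in at_right t. s \<in> ?S \<and> s > 0 \<and> s > t"
  proof -
    have "\<forall>\<^sub>F s in at_right t. err l s \<noteq> 0" if "l \<in> {1..<i}" for l
    proof -
      have "(err l \<longlongrightarrow> err l t) (at t within {0..})"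
        using err_cont[of l] that \<open>i \<le> j\<close> less.prems by (auto simp: continuous_on)
      then have "(err l \<longlongrightarrow> err l t) (at_right t)"
        using le by (rule tendsto_mono[rotated])
      then show ?thesis
        by (rule tendsto_imp_eventually_ne) (use that before in auto)
    qed
    then have "\<forall>\<^sub>F s in at_right t. \<forall>l\<in>{1..<i}. err l s \<noteq> 0"
      by (intro eventually_ball_finite) auto
    then show ?thesis
      using eventually_at_right_less[of t] by eventually_elim (use less.prems in auto)
  qed
  have right: "(f has_real_derivative d) (at_right t)"
    if "(f has_real_derivative d) (at t within {0..})" for f d
    by (rule has_field_derivative_subset[OF that]) (use less.prems in auto)
  define X where "X l s = xd s (i + l) - F l s" for l s
  define dX where "dX l s = dxd s (i + l) - F (Suc l) s" for l s
  have X: "(X l has_real_derivative dX l s) (at s within {0..})" if "l \<le> m" "s \<in> ?S" for l s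
    unfolding X_def[abs_def] dX_def
    by (intro DERIV_diff xd_deriv F) (use that m i less.prems in auto)
  have "err (i + m) t = 0"
  proof (rule cascade_zero[where e = "\<lambda>l. err (i + l)" and X = X and dX = dX and k = "\<lambda>l. k (i + l)"])
    show "m \<ge> 1" by fact
    show "k (i + l) > 0" if "l < m" for l
      using that m i less.prems by (intro k_pos) auto
    show "\<alpha> < 1" by (rule \<alpha>_less)
    \<comment> \<open>Here the lower bound on \<alpha> enters, in the form
      \<open>m \<le> n < homdeg\<close>.\<close>
    have "(1 - \<alpha>) * real m < 1"
    proof -
      have "real m < homdeg" using homdeg_gt m i less.prems by linarith
      then have "(1 - \<alpha>) * real m < (1 - \<alpha>) * homdeg" using \<alpha>_less by (intro mult_strict_left_mono) auto
      then show ?thesis by (simp add: homdeg_mult)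
    qed
    then show "real m - 1 < \<alpha> * real m" by (simp add: algebra_simps)
    have e: "(err (i + l) has_real_derivative err (i + Suc l) s - k (i + l) * sig_pow \<alpha> (err (i + l) s)) (at s within {0..})"
      if "l < m" "s \<ge> 0" for l s
      using err_deriv[of "i + l" s] that m i less.prems by simp
    show "\<forall>\<^sub>F s in at_right t. (err (i + l) has_real_derivative err (i + Suc l) s - k (i + l) * sig_pow \<alpha> (err (i + l) s)) (at s)"
      if "l < m" for l
      using ev by eventually_elim (intro DERIV_within_Ici_interior e that, auto)
    show "(err (i + l) has_real_derivative err (i + Suc l) t - k (i + l) * sig_pow \<alpha> (err (i + l) t)) (at_right t)"
      if "l < m" for l
      by (intro right e that less.prems)
    have "(err (i + m) \<longlongrightarrow> err (i + m) t) (at t within {0..})"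
      using err_cont[of "i + m"] m i less.prems by (auto simp: continuous_on)
    then show "continuous (at_right t) (err (i + m))"
      using le by (auto simp: continuous_within intro: tendsto_mono)
    show "\<forall>\<^sub>F s in at_right t. (X l has_real_derivative dX l s) (at s)" if "l \<le> m" for l
      using ev by eventually_elim (intro DERIV_within_Ici_interior X that, auto)
    show "(X l has_real_derivative dX l t) (at_right t)" if "l \<le> m" for l
      by (intro right X that tS)
    show "\<forall>\<^sub>F s in at_right t. X (Suc l) s = dX l s - k (i + l) * sig_pow \<alpha> (err (i + l) s)"
      if "l < m" for l
      using ev
    proof eventually_elim
      case (elim s)
      then show ?case
        using xd_Suc[of "i + l" s] that m i less.prems by (simp add: X_def dX_def)
    qed
    show "\<forall>\<^sub>F s in at_right t. X 0 s = 0" "X 0 t = 0" by (simp_all add: X_def F0)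
    show "err (i + l) t = 0" if "l < m" for l
      using block[of "i + l"] that m by simp
  qed
  then show ?case by (simp add: m)
qed

section \<open>Persistence of zeros and finite-time vanishing of the errors\<close>

lemma err_zero_above:
  assumes "1 \<le> i" "i \<le> l" "0 \<le> t" "err i t = 0"
  shows "err l t = 0"
  using assms(2)
proof (induction rule: dec_induct)
  case (step l)
  then show ?case using err_zero_step[of l t] assms by (cases "l < n") (auto simp: err_def)
qed (rule assms)

text \<open>Downward induction from \<open>err (Suc n) = 0\<close>: a zero of \<open>err i\<close>
  at \<open>s\<close> is also one of \<open>err (Suc i)\<close>, which then vanishes from
  \<open>s\<close> on and leaves the pure decay equation for \<open>err i\<close>.\<close>

lemma err_zero_persists:
  assumes "1 \<le> i" "0 \<le> s" "s \<le> t" "err i s = 0"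
  shows "err i t = 0"
proof (cases "i \<le> n")
  case True
  have "\<forall>t\<ge>s. err i t = 0" if "i \<le> Suc n" "1 \<le> i" "err i s = 0" for i
    using that
  proof (induction rule: inc_induct)
    case base
    show ?case by (simp add: err_def)
  next
    case (step i)
    have "err (Suc i) s = 0"
      by (rule err_zero_above[of i]) (use step.prems assms(2) in auto)
    then have zero: "err (Suc i) t = 0" if "t \<ge> s" for t using step.IH that by simp
    have "err i t = 0" if "s \<le> t" for t
    proof (rule sig_pow_decay_zero[of s "err i" "k i" \<alpha> t])
      show "(err i has_real_derivative - k i * sig_pow \<alpha> (err i t)) (at t within {0..})" if "t \<ge> s" for t
        using err_deriv[of i t] zero[OF that] step.hyps step.prems that assms(2) by simp
    qed (use step.hyps step.prems that assms(2) k_pos[of i] in auto)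
    then show ?case by blast
  qed
  then show ?thesis using True assms by simp
qed (simp add: err_def)

text \<open>Once \<open>err (Suc i)\<close> has vanished for good, \<open>err i\<close> obeys the
  pure decay equation. After the zero of \<open>err 1\<close> is reached, propagation along the
  cascade gives one common time.\<close>

lemma err_zero_finite_time: "\<exists>T\<ge>0. \<forall>t\<ge>T. \<forall>i\<ge>1. err i t = 0"
proof -
  have "\<exists>T\<ge>0. err i T = 0" if "i \<le> Suc n" "1 \<le> i" for i
    using that
  proof (induction rule: inc_induct)
    case base
    show ?case by (auto simp: err_def)
  next
    case (step i)
    then obtain T where T: "T \<ge> 0" "err (Suc i) T = 0" by auto
    have "\<exists>T'\<ge>T. err i T' = 0"
    proof (rule sig_pow_decay_finite_time[of T "err i" "k i" \<alpha>])
      show "(err i has_real_derivative - k i * sig_pow \<alpha> (err i t)) (at t within {0..})" if "t \<ge> T" for t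
        using err_deriv[of i t] err_zero_persists[of "Suc i" T t] T step that by simp
    qed (use step T k_pos[of i] \<alpha>_less in auto)
    then show ?case using T by (auto intro: order_trans)
  qed
  from this[of 1] obtain T where T: "T \<ge> 0" "err 1 T = 0" by auto
  then have "err i t = 0" if "t \<ge> T" "i \<ge> 1" for i t
    using err_zero_persists[of 1 T t] err_zero_above[of 1 i t] that by simp
  then show ?thesis using T by blast
qed

section \<open>Growth estimates and smoothness of the references\<close>

lemma err_bounded: 
  assumes "1 \<le> i" "i \<le> n"
  obtains K where "K > 0" "\<And>t. t \<ge> 0 \<Longrightarrow> \<bar>err i t\<bar> \<le> K"
proof -
  obtain T where "\<And>t. t \<ge> T \<Longrightarrow> err i t = 0"
    using err_zero_finite_time assms by blast
  from bounded_of_eventually_zero[OF err_cont[OF assms] this] show ?thesis using that by blast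
qed

text \<open>Downward induction: the bound on \<open>err (Suc (Suc i))\<close> controls the
  derivative of \<open>err (Suc i)\<close>, which is what \<open>tracking_bound\<close> asks of the
  tracked function.\<close>

lemma err_Suc_bound:
  assumes "1 \<le> i" "i \<le> n"
  shows "\<exists>D. \<forall>t\<ge>0. \<bar>err (Suc i) t\<bar> \<le> D * \<bar>err i t\<bar> powr \<alpha>"
  using assms(2,1)
proof (induction rule: inc_induct)
  case base
  show ?case by (intro exI[of _ 0]) (simp add: err_def)
next
  case (step i)
  then obtain D where D: "\<And>t. t \<ge> 0 \<Longrightarrow> \<bar>err (Suc (Suc i)) t\<bar> \<le> D * \<bar>err (Suc i) t\<bar> powr \<alpha>"
    by auto
  obtain T where T: "T \<ge> 0" "\<And>i. i \<ge> 1 \<Longrightarrow> err i T = 0" using err_zero_finite_time by blast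
  show ?case
  proof (rule tracking_bound[of "err i" "err (Suc i)" "k i" \<alpha>
        "\<lambda>t. err (Suc (Suc i)) t - k (Suc i) * sig_pow \<alpha> (err (Suc i) t)" "D + k (Suc i)" T])
    show "(err i has_real_derivative err (Suc i) t - k i * sig_pow \<alpha> (err i t)) (at t within {0..})"
      if "t \<ge> 0" for t using err_deriv[of i t] step that by simp
    show "(err (Suc i) has_real_derivative err (Suc (Suc i)) t - k (Suc i) * sig_pow \<alpha> (err (Suc i) t)) (at t within {0..})"
      if "t \<ge> 0" for t using err_deriv[of "Suc i" t] step that by simp
    show "\<bar>err (Suc (Suc i)) t - k (Suc i) * sig_pow \<alpha> (err (Suc i) t)\<bar> \<le> (D + k (Suc i)) * \<bar>err (Suc i) t\<bar> powr \<alpha>"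
      if "t \<ge> 0" for t
    proof -
      have "\<bar>k (Suc i) * sig_pow \<alpha> (err (Suc i) t)\<bar> = k (Suc i) * \<bar>err (Suc i) t\<bar> powr \<alpha>"
        using k_pos[of "Suc i"] step by (simp add: abs_mult abs_sig_pow)
      then show ?thesis using D[OF that] by (simp add: distrib_right)
    qed
    show "err i t = 0" if "0 \<le> s" "s \<le> t" "err i s = 0" for s t
      using err_zero_persists[of i s t] that step by simp
    show "err (Suc i) t = 0" if "0 \<le> s" "s \<le> t" "err (Suc i) s = 0" for s t
      using err_zero_persists[of "Suc i" s t] that step by simp
    show "err (Suc i) t = 0" if "0 \<le> t" "err i t = 0" for t
      using err_zero_above[of i "Suc i" t] that step by simp
    show "err i T = 0" using T step by simp
    show "k i > 0" using k_pos[of i] step by simp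
  qed (use T \<alpha>_pos \<alpha>_less in auto)
qed

lemma radius_lipschitz:
  assumes "1 \<le> i" "i \<le> n"
  shows "\<exists>L. \<forall>s\<ge>0. \<forall>t\<ge>0. radius i t = 0 \<longrightarrow> radius i s \<le> L * \<bar>s - t\<bar>"
proof -
  obtain D where D: "\<And>t. t \<ge> 0 \<Longrightarrow> \<bar>err (Suc i) t\<bar> \<le> D * \<bar>err i t\<bar> powr \<alpha>"
    using err_Suc_bound[OF assms] by blast
  define B where "B = \<bar>D\<bar> + k i"
  have "k i > 0" using k_pos assms by simp
  have "radius i s \<le> (1 - \<alpha>) * B * \<bar>s - t\<bar>" if "s \<ge> 0" "t \<ge> 0" "radius i t = 0" for s t
    unfolding radius_def
  proof (rule tracking_radius_lipschitz[OF err_deriv[OF assms]])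
    show "\<bar>err (Suc i) t - k i * sig_pow \<alpha> (err i t)\<bar> \<le> B * \<bar>err i t\<bar> powr \<alpha>"
      if "t \<ge> 0" for t
    proof -
      have "\<bar>k i * sig_pow \<alpha> (err i t)\<bar> = k i * \<bar>err i t\<bar> powr \<alpha>"
        using \<open>k i > 0\<close> by (simp add: abs_mult abs_sig_pow)
      moreover have "D * \<bar>err i t\<bar> powr \<alpha> \<le> \<bar>D\<bar> * \<bar>err i t\<bar> powr \<alpha>"
        by (intro mult_right_mono) auto
      ultimately show ?thesis using D[OF that] unfolding B_def distrib_right by linarith
    qed
    show "err i t = 0" if "0 \<le> s" "s \<le> t" "err i s = 0" for s t
      using err_zero_persists[of i s t] that assms by simp
    show "err i t = 0" using that(3) by (simp add: radius_def)
  qed (use that \<open>k i > 0\<close> \<alpha>_less in \<open>auto simp: B_def\<close>)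
  then show ?thesis by blast
qed

lemma radius_nonneg: "radius i t \<ge> 0"
  by (simp add: radius_def)

lemma radius_bounded:
  assumes "1 \<le> i" "i \<le> n"
  obtains R where "R > 0" "\<And>t. t \<ge> 0 \<Longrightarrow> radius i t \<le> R"
proof -
  obtain K where K: "K > 0" "\<And>t. t \<ge> 0 \<Longrightarrow> \<bar>err i t\<bar> \<le> K"
    using err_bounded[OF assms] by blast
  show ?thesis
  proof (rule that[of "K powr (1 - \<alpha>)"])
    show "radius i t \<le> K powr (1 - \<alpha>)" if "t \<ge> 0" for t
      unfolding radius_def using K(2)[OF that] \<alpha>_less by (intro powr_mono2) auto
  qed (use K in simp)
qed

lemma err_eq_radius: "\<bar>err i t\<bar> = radius i t powr homdeg"
  by (simp add: radius_def powr_powr homdeg_mult)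

text \<open>Downward induction. Passing from \<open>radius (Suc i)\<close> to
  \<open>radius i\<close> costs \<open>err (Suc i)\<close> one degree, and it becomes differentiable
  across its zeros; solving the equation of \<open>err i\<close> then gains one derivative and
  restores that degree.\<close>

lemma err_weighted_diff:
  assumes "1 \<le> i" "i \<le> n"
  shows "weighted_diff {0..} {t. t \<ge> 0 \<and> radius i t > 0} (radius i) (n - i) homdeg (err i)"
  using assms(2,1)
proof (induction rule: inc_induct)
  case base
  show ?case by (auto simp: err_eq_radius intro!: exI[of _ 1])
next
  case (step i)
  have i: "1 \<le> i" "i \<le> n" "1 \<le> Suc i" "Suc i \<le> n" using step by auto
  obtain L where L: "\<And>s t. s \<ge> 0 \<Longrightarrow> t \<ge> 0 \<Longrightarrow> radius (Suc i) t = 0 \<Longrightarrow> radius (Suc i) s \<le> L * \<bar>s - t\<bar>"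
    using radius_lipschitz[OF i(3,4)] by blast
  obtain D where D: "\<And>t. t \<ge> 0 \<Longrightarrow> \<bar>err (Suc i) t\<bar> \<le> D * \<bar>err i t\<bar> powr \<alpha>"
    using err_Suc_bound[OF i(1,2)] by blast
  obtain R where R: "R > 0" "\<And>t. t \<ge> 0 \<Longrightarrow> radius i t \<le> R"
    using radius_bounded[OF i(1,2)] by blast
  have comparison: "radius (Suc i) t \<le> \<bar>D\<bar> powr (1 - \<alpha>) * radius i t powr \<alpha>" if "t \<ge> 0" for t
  proof -
    have "D * \<bar>err i t\<bar> powr \<alpha> \<le> \<bar>D\<bar> * \<bar>err i t\<bar> powr \<alpha>"
      by (intro mult_right_mono) auto
    then have "radius (Suc i) t \<le> (\<bar>D\<bar> * \<bar>err i t\<bar> powr \<alpha>) powr (1 - \<alpha>)"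
      unfolding radius_def using D[OF that] \<alpha>_less by (intro powr_mono2) auto
    also have "\<dots> = \<bar>D\<bar> powr (1 - \<alpha>) * radius i t powr \<alpha>"
      by (simp add: radius_def powr_mult powr_powr mult.commute)
    finally show ?thesis .
  qed
  have "weighted_diff {0..} {0..} (radius i) (n - Suc i) (homdeg - 1) (err (Suc i))"
  proof (rule weighted_diff_change_weight[OF L radius_nonneg])
    show "real (n - Suc i) < homdeg" using homdeg_gt by linarith
    show "weighted_diff {0..} {t. 0 \<le> t \<and> 0 < radius (Suc i) t} (radius (Suc i)) (n - Suc i) homdeg (err (Suc i))"
      using step by simp
    fix s assume s: "0 < s" "s \<le> homdeg"
    \<comment> \<open>The comparison gives the power \<open>\<alpha> * s\<close> of
      \<open>radius i\<close>, which exceeds \<open>s - 1\<close> by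
      \<open>1 - (1 - \<alpha>) * s\<close>. This excess is nonnegative for
      \<open>s \<le> homdeg\<close> and is absorbed by the bound \<open>R\<close>.\<close>
    have "(1 - \<alpha>) * s \<le> (1 - \<alpha>) * homdeg" using s \<alpha>_less by (intro mult_left_mono) auto
    then have exponent: "1 - (1 - \<alpha>) * s \<ge> 0" by (simp add: homdeg_mult)
    have "radius (Suc i) t powr s \<le> (\<bar>D\<bar> powr (1 - \<alpha>)) powr s * R powr (1 - (1 - \<alpha>) * s) * radius i t powr (s - 1)"
      if "t \<ge> 0" for t
    proof -
      have "radius (Suc i) t powr s \<le> (\<bar>D\<bar> powr (1 - \<alpha>) * radius i t powr \<alpha>) powr s"
        using comparison[OF that] s radius_nonneg by (intro powr_mono2) auto
      also have "\<dots> = (\<bar>D\<bar> powr (1 - \<alpha>)) powr s * radius i t powr ((s - 1) + (1 - (1 - \<alpha>) * s))"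
        by (simp add: powr_mult powr_powr algebra_simps)
      also have "\<dots> \<le> (\<bar>D\<bar> powr (1 - \<alpha>)) powr s * (R powr (1 - (1 - \<alpha>) * s) * radius i t powr (s - 1))"
        by (intro mult_left_mono powr_le_const_mult radius_nonneg R(2) that exponent) auto
      finally show ?thesis by (simp add: mult.assoc)
    qed
    then show "\<exists>C. \<forall>t\<ge>0. radius (Suc i) t powr s \<le> C * radius i t powr (s - 1)" by blast
  qed
  then have "weighted_diff {0..} {t. t \<ge> 0 \<and> radius i t > 0} (radius i) (n - Suc i) (homdeg - 1) (err (Suc i))"
    by (rule weighted_diff_subset[rotated]) auto
  then have "weighted_diff {0..} {t. t \<ge> 0 \<and> radius i t > 0} (radius i) (Suc (n - Suc i)) homdeg (err i)"
  proof (rule weighted_diff_solution[rotated -1])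
    show "(err i has_real_derivative err (Suc i) t - k i * sig_pow \<alpha> (err i t)) (at t within {0..})"
      if "t \<in> {t. t \<ge> 0 \<and> radius i t > 0}" for t
      using err_deriv[of i t] i that by simp
    show "err i t \<noteq> 0" if "t \<in> {t. t \<ge> 0 \<and> radius i t > 0}" for t
      using that by (auto simp: radius_def)
  qed (rule err_eq_radius homdeg_\<alpha>)+
  moreover have "Suc (n - Suc i) = n - i" using step.hyps by simp
  ultimately show ?case by (simp only:)
qed

text \<open>The signed power has degree \<open>homdeg - 1\<close>. Changing to the weight 1 yields
  derivatives on the whole half line, also at zeros, provided \<open>n - i < homdeg - 1\<close>; the
  tightest case \<open>i = 1\<close> is the condition \<open>n < homdeg\<close>.\<close>

lemma sig_pow_err_smooth:
  assumes "1 \<le> i" "i \<le> n"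
  shows "weighted_diff {0..} {0..} (\<lambda>_. 1) (n - i) 0 (\<lambda>t. sig_pow \<alpha> (err i t))"
proof -
  obtain L where L: "\<And>s t. s \<ge> 0 \<Longrightarrow> t \<ge> 0 \<Longrightarrow> radius i t = 0 \<Longrightarrow> radius i s \<le> L * \<bar>s - t\<bar>"
    using radius_lipschitz[OF assms] by blast
  obtain R where R: "R > 0" "\<And>t. t \<ge> 0 \<Longrightarrow> radius i t \<le> R"
    using radius_bounded[OF assms] by blast
  have wd: "weighted_diff {0..} {t. t \<ge> 0 \<and> radius i t > 0} (radius i) (n - i) (homdeg * \<alpha>) (\<lambda>t. sig_pow \<alpha> (err i t))"
    by (rule weighted_diff_powr[THEN conjunct2, OF _ err_eq_radius err_weighted_diff[OF assms]])
       (auto simp: radius_def)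
  have "weighted_diff {0..} {0..} (\<lambda>_. 1) (n - i) (homdeg * \<alpha> - 0) (\<lambda>t. sig_pow \<alpha> (err i t))"
  proof (rule weighted_diff_change_weight[OF L radius_nonneg _ wd])
    show "real (n - i) < homdeg * \<alpha>" using homdeg_gt assms by (simp add: homdeg_\<alpha> of_nat_diff)
    fix s :: real assume "0 < s"
    then have "radius i t powr s \<le> R powr s" if "t \<ge> 0" for t
      using R(2)[OF that] radius_nonneg by (intro powr_mono2) auto
    then show "\<exists>C. \<forall>t\<ge>0. radius i t powr s \<le> C * 1 powr (s - 0)" by auto
  qed
  then show ?thesis by (rule weighted_diff_one_exponent)
qed

text \<open>Now the derivatives are bounded on \<open>{0..}\<close> as well. Each recursion step
  costs one of them, and exactly one is left for \<open>xd t n\<close>, which is what bounds the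
  control.\<close>

lemma xd_smooth:
  assumes "1 \<le> i" "i \<le> n"
  shows "weighted_diff {0..} {0..} (\<lambda>_. 1) (n - i + 1) 0 (\<lambda>t. xd t i)"
  using assms
proof (induction rule: dec_induct)
  have op: "\<forall>\<^sub>F s in at t within {0..}. s \<in> {0..}" for t :: real
    by (simp add: eventually_at_filter)
  {
    case base
    show ?case
      by (rule weighted_diff_cong[OF _ _ op weighted_diff_const[of "{0..}" x1d]]) (use xd_1 in auto)
  next
    case (step i)
    have i: "n - Suc i + 1 = n - i" using step by simp
    have "weighted_diff {0..} {0..} (\<lambda>_. 1) (n - i) (0 - 1) (\<lambda>t. dxd t i)"
      by (rule weighted_diff_derivative[OF _ _ op]) (use step xd_deriv[of i] in auto)
    then have "weighted_diff {0..} {0..} (\<lambda>_. 1) (n - i) 0 (\<lambda>t. dxd t i)"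
      by (rule weighted_diff_one_exponent)
    then have "weighted_diff {0..} {0..} (\<lambda>_. 1) (n - i) 0 (\<lambda>t. dxd t i + (- k i) * sig_pow \<alpha> (err i t))"
      using sig_pow_err_smooth[of i] step by (intro weighted_diff_add weighted_diff_cmult) auto
    then show ?case
      unfolding i by (rule weighted_diff_cong[OF _ _ op, rotated -1]) (use xd_Suc[of i] step in auto)
  }
qed

lemma dxd_bounded: "\<exists>C. \<forall>t\<ge>0. \<bar>dxd t n\<bar> \<le> C"
proof -
  have "weighted_diff {0..} {0..} (\<lambda>_. 1) 0 (0 - 1) (\<lambda>t. dxd t n)"
    by (rule weighted_diff_derivative)
       (use xd_smooth[of n] xd_deriv[of n] n in \<open>auto simp: eventually_at_filter\<close>)
  then show ?thesis by auto
qed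

section \<open>Convergence of the state and boundedness of the control\<close>

lemma desired_state_after:
  assumes "T \<ge> 0" and zero: "\<And>t i. t \<ge> T \<Longrightarrow> i \<ge> 1 \<Longrightarrow> err i t = 0"
    and "1 \<le> i" "i \<le> n" "t > T"
  shows "x t i = desired_state x1d i"
proof -
  have "\<forall>t>T. xd t i = desired_state x1d i \<and> dxd t i = 0"
    using assms(3,4)
  proof (induction rule: dec_induct)
    case base
    then show ?case using xd_1 dxd_1 assms(1) by (simp add: desired_state_def)
  next
    case (step i)
    have xd0: "xd t (Suc i) = 0" if "t > T" for t
      using xd_Suc[of i t] zero[of t i] step that assms(1) by (simp add: sig_pow_def)
    \<comment> \<open>The strict inequality places \<open>t\<close> in an open set on which the
      reference vanishes, so its derivative vanishes too and the next reference is again 0.\<close>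
    have "dxd t (Suc i) = 0" if "t > T" for t
    proof -
      have "((\<lambda>_. 0) has_real_derivative 0) (at t)" by simp
      then have "((\<lambda>s. xd s (Suc i)) has_real_derivative 0) (at t)"
        by (rule has_field_derivative_transform_within_open[where S = "{T<..}"]) (use that xd0 in auto)
      then have "((\<lambda>s. xd s (Suc i)) has_real_derivative 0) (at t within {0..})"
        by (rule has_field_derivative_at_within)
      then show ?thesis
        using has_real_derivative_within_Ici_unique xd_deriv[of "Suc i" t] step that assms(1) by auto
    qed
    then show ?case using xd0 step by (simp add: desired_state_def)
  qed
  then show ?thesis using zero[of t i] assms by (simp add: err_def)
qed

lemma desired_state_finite_time:
  "\<exists>T\<ge>0. \<forall>t\<ge>T. \<forall>i\<in>{1..n}. x t i = desired_state x1d i"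
proof -
  obtain T where T: "T \<ge> 0" "\<And>t i. t \<ge> T \<Longrightarrow> i \<ge> 1 \<Longrightarrow> err i t = 0"
    using err_zero_finite_time by blast
  \<comment> \<open>Adding 1 turns the strict inequality \<open>t > T\<close> into a closed half
    line.\<close>
  have "x t i = desired_state x1d i" if "t \<ge> T + 1" "i \<in> {1..n}" for t i
    by (rule desired_state_after[OF T]) (use that in auto)
  then show ?thesis using T(1) by (intro exI[of _ "T + 1"]) auto
qed

lemma x_bounded:
  assumes "i \<in> {1..n}"
  shows "\<exists>C. \<forall>t\<ge>0. \<bar>x t i\<bar> \<le> C"
proof -
  obtain T where T: "T \<ge> 0" "\<And>t. t \<ge> T \<Longrightarrow> x t i = desired_state x1d i"
    using desired_state_finite_time assms by blast
  have "continuous_on {0..} (\<lambda>t. x t i)"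
    using assms by (cases "i = n")
      (auto intro!: DERIV_continuous_on[OF x_n_deriv] DERIV_continuous_on[OF x_deriv[of i]])
  then have "continuous_on {0..} (\<lambda>t. x t i - desired_state x1d i)"
    by (intro continuous_intros)
  moreover have "x t i - desired_state x1d i = 0" if "t \<ge> T" for t using T(2)[OF that] by simp
  ultimately obtain K where "\<And>t. t \<ge> 0 \<Longrightarrow> \<bar>x t i - desired_state x1d i\<bar> \<le> K"
    using bounded_of_eventually_zero by blast
  then have "\<bar>x t i\<bar> \<le> K + \<bar>desired_state x1d i\<bar>" if "t \<ge> 0" for t
    using that by fastforce
  then show ?thesis by blast
qed

lemma control_bounded: "bounded (u ` {0..})"
proof -
  obtain C where C: "\<And>t. t \<ge> 0 \<Longrightarrow> \<bar>dxd t n\<bar> \<le> C" using dxd_bounded by blast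
  obtain K where K: "K > 0" "\<And>t. t \<ge> 0 \<Longrightarrow> \<bar>err n t\<bar> \<le> K" using err_bounded[of n] n by blast
  obtain X where X: "\<And>i t. i \<in> {1..n} \<Longrightarrow> t \<ge> 0 \<Longrightarrow> \<bar>x t i\<bar> \<le> X i" using x_bounded by metis
  have "\<bar>u t\<bar> \<le> C + (\<Sum>i=1..n. \<bar>a i\<bar> * X i) + k n * K powr \<alpha>" if t: "t \<ge> 0" for t
  proof -
    have "u t = dxd t n - (\<Sum>i=1..n. a i * x t i) - k n * sig_pow \<alpha> (err n t)"
      using control t by (simp add: control_law_def err_def)
    moreover have "\<bar>\<Sum>i=1..n. a i * x t i\<bar> \<le> (\<Sum>i=1..n. \<bar>a i\<bar> * X i)"
      by (rule order_trans[OF sum_abs]) (auto simp: abs_mult intro!: sum_mono mult_left_mono X t)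
    moreover have "\<bar>k n * sig_pow \<alpha> (err n t)\<bar> \<le> k n * K powr \<alpha>"
      using K(2)[OF t] k_pos[of n] n \<alpha>_pos
      by (auto simp: abs_mult abs_sig_pow intro!: mult_left_mono powr_mono2)
    ultimately show ?thesis using C[OF t] by linarith
  qed
  then show ?thesis by (auto simp: bounded_iff)
qed

end

theorem theorem7:
  fixes n :: nat and a k :: "nat \<Rightarrow> real" and \<alpha> x1d :: real
    and x xd dxd :: "real \<Rightarrow> nat \<Rightarrow> real" and u :: "real \<Rightarrow> real"
  assumes "n \<ge> 1"
    and "\<forall>i\<in>{1..n}. k i > 0"
    and "(real n - 1) / real n < \<alpha>" and "\<alpha> < 1"
    and "canonical_form_trajectory n a u x"
    and "reference_recursion n k \<alpha> x1d x xd dxd"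
    and "control_law n a k \<alpha> x xd dxd u"
  shows "(\<exists>T\<ge>0. \<forall>t\<ge>T. \<forall>i\<in>{1..n}. x t i = desired_state x1d i) \<and> bounded (u ` {0..})"
proof -
  interpret closed_loop n a k \<alpha> x1d x xd dxd u
    using assms by unfold_locales auto
  show ?thesis
    using desired_state_finite_time control_bounded ..
qed

end
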